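(* Let $\mathcal{G},\mathcal{H}\subset L^{0,+}$ satisfy $\sup_{M\in\mathcal{G}\cup\mathcal{H}}\mathbb{E}[M]<\infty$, with $\mathcal{G}$ convex and closed with respect to convergence in probability. Suppose that one of the following conditions is satisfied: (C1) $\mathcal{G}$ and $\mathcal{H}$ are singletons, and there exists an $\mathcal{F}$-measurable random variable with a continuous cumulative distribution function with respect to $\mathbb{P}$; (C2) there exists an $\mathcal{F}$-measurable random variable with continuous cumulative distribution function that is independent of $\sigma(\mathcal{G}\cup\mathcal{H})$; (C3) for all $0<x<\sup_{H\in\mathcal{H}}\mathbb{E}[H]$, an associated optimal triplet $(\hat G,\hat H,\hat a)\in\mathcal{G}\times\overline{co(\mathcal{H})}\times[0,\infty)$ (as defined in the context) satisfies $\mathbb{P}\{\hat G=\hat a\hat H\}=0$. Then $V_1(x)=V(x)$ for every $x>0$, and there exists an indicator random variable $\hat X$ (depending on $x$) that solves both problems defining $V(x)$ and $V_1(x)$ simultaneously. Furthermore, $x\mapsto V_1(x)$ is continuous, concave, and non-decreasing.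
   Context: $(\Omega,\mathcal{F},\mathbb{P})$ is a complete probability space, $\mathbb{E}$ is expectation under $\mathbb{P}$, and $L^{0,+}$ is the space of non-negative $\mathcal{F}$-measurable random variables with the topology of convergence in probability. $\mathcal{X}$ is the set of $\mathcal{F}$-measurable random variables with values in $[0,1]$ (randomized tests) and $\mathcal{I}$ the set of those with values in $\{0,1\}$ (pure tests). For $x>0$ put $\mathcal{X}_x=\{X\in\mathcal{X}:\mathbb{E}[HX]\le x\ \forall H\in\mathcal{H}\}$, $\mathcal{I}_x=\{X\in\mathcal{I}:\mathbb{E}[HX]\le x\ \forall H\in\mathcal{H}\}$, $$V(x)=\sup_{X\in\mathcal{X}_x}\inf_{G\in\mathcal{G}}\mathbb{E}[GX],\qquad V_1(x)=\sup_{X\in\mathcal{I}_x}\inf_{G\in\mathcal{G}}\mathbb{E}[GX].$$ "Solves" means attains the supremum (and is feasible). $\overline{co(\mathcal{H})}$ is the closure, in the topology of convergence in probability, of the convex hull of $\mathcal{H}$. $\sigma(\mathcal{G}\cup\mathcal{H})$ is the $\sigma$-algebra generated by the random variables in $\mathcal{G}\cup\mathcal{H}$. A triplet $(\hat G,\hat H,\hat a)\in\mathcal{G}\times\overline{co(\mathcal{H})}\times[0,\infty)$ is an optimal triplet associated with $x$ if there exists $\hat X\in\mathcal{X}_x$ such that: $\hat X=I_{\{\hat G>\hat a\hat H\}}+B\,I_{\{\hat G=\hat a\hat H\}}$ for some $[0,1]$-valued $\mathcal{F}$-measurable $B$; $\mathbb{E}[H\hat X]\le\mathbb{E}[\hat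 H\hat X]=x$ for all $H\in\mathcal{H}$; and $\mathbb{E}[\hat G\hat X]\le\mathbb{E}[G\hat X]$ for all $G\in\mathcal{G}$. *)

theory Defs
  imports "HOL-Probability.Probability"
begin

text \<open>
  Random variables are functions rather than classes modulo almost sure equality. All values
  outside \<^term>\<open>space M\<close> are irrelevant. Expectations of non-negative random variables are
  \<^typ>\<open>ennreal\<close>-valued.
\<close>

definition L0_plus :: "'a measure \<Rightarrow> ('a \<Rightarrow> real) set" where
  "L0_plus M = {Z \<in> borel_measurable M. \<forall>\<omega>\<in>space M. 0 \<le> Z \<omega>}"

definition randomized_tests :: "'a measure \<Rightarrow> ('a \<Rightarrow> real) set" where
  "randomized_tests M = {X \<in> borel_measurable M. \<forall>\<omega>\<in>space M. 0 \<le> X \<omega> \<and> X \<omega> \<le> 1}"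

definition pure_tests :: "'a measure \<Rightarrow> ('a \<Rightarrow> real) set" where
  "pure_tests M = {X \<in> borel_measurable M. \<forall>\<omega>\<in>space M. X \<omega> \<in> {0, 1}}"

definition expect :: "'a measure \<Rightarrow> ('a \<Rightarrow> real) \<Rightarrow> ennreal" where
  "expect M Z = (\<integral>\<^sup>+ \<omega>. ennreal (Z \<omega>) \<partial>M)"


text \<open>
  The topology of convergence in probability on \<^term>\<open>L0_plus M\<close>: the sets
  \<open>{Y. P(|Y - X| > e) < e}\<close>, for \<open>e > 0\<close>, form a neighbourhood base at \<open>X\<close>.
\<close>

definition prob_open :: "'a measure \<Rightarrow> ('a \<Rightarrow> real) set \<Rightarrow> bool" where
  "prob_open M U \<longleftrightarrow> U \<subseteq> L0_plus M \<and>
     (\<forall>X\<in>U. \<exists>e>0. \<forall>Y\<in>L0_plus M.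
        measure M {\<omega>\<in>space M. \<bar>Y \<omega> - X \<omega>\<bar> > e} < e \<longrightarrow> Y \<in> U)"

definition prob_topology :: "'a measure \<Rightarrow> ('a \<Rightarrow> real) topology" where
  "prob_topology M = topology (prob_open M)"

lemma istopology_prob_open:
  assumes "finite_measure M"
  shows "istopology (prob_open M)"
  unfolding istopology_def
proof (intro conjI allI impI)
  interpret finite_measure M by fact
  fix S T assume S: "prob_open M S" and T: "prob_open M T"
  show "prob_open M (S \<inter> T)"
    unfolding prob_open_def
  proof (intro conjI ballI)
    show "S \<inter> T \<subseteq> L0_plus M" using S by (auto simp: prob_open_def)
    fix X assume X: "X \<in> S \<inter> T"
    then have mX: "X \<in> borel_measurable M"
      using S by (auto simp: prob_open_def L0_plus_def)
    obtain d where d: "d > 0" "\<And>Y. Y \<in> L0_plus M \<Longrightarrow>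
        measure M {\<omega>\<in>space M. \<bar>Y \<omega> - X \<omega>\<bar> > d} < d \<Longrightarrow> Y \<in> S"
      using S X unfolding prob_open_def by blast
    obtain e where e: "e > 0" "\<And>Y. Y \<in> L0_plus M \<Longrightarrow>
        measure M {\<omega>\<in>space M. \<bar>Y \<omega> - X \<omega>\<bar> > e} < e \<Longrightarrow> Y \<in> T"
      using T X unfolding prob_open_def by blast
    have mono: "measure M {\<omega>\<in>space M. \<bar>Y \<omega> - X \<omega>\<bar> > b} \<le> measure M {\<omega>\<in>space M. \<bar>Y \<omega> - X \<omega>\<bar> > a}"
      if "Y \<in> L0_plus M" "a \<le> b" for Y a b
    proof (rule finite_measure_mono)
      have [measurable]: "Y \<in> borel_measurable M" "X \<in> borel_measurable M"
        using that mX by (auto simp: L0_plus_def)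
      show "{\<omega>\<in>space M. \<bar>Y \<omega> - X \<omega>\<bar> > a} \<in> sets M" by measurable
    qed (use that in auto)
    show "\<exists>r>0. \<forall>Y\<in>L0_plus M. measure M {\<omega>\<in>space M. \<bar>Y \<omega> - X \<omega>\<bar> > r} < r \<longrightarrow> Y \<in> S \<inter> T"
    proof (intro exI[of _ "min d e"] conjI ballI impI)
      fix Y assume Y: "Y \<in> L0_plus M"
        and lt: "measure M {\<omega>\<in>space M. \<bar>Y \<omega> - X \<omega>\<bar> > min d e} < min d e"
      show "Y \<in> S \<inter> T"
        using d(2)[OF Y] e(2)[OF Y] mono[OF Y, of "min d e" d] mono[OF Y, of "min d e" e] lt
        by simp
    qed (use d e in auto)
  qed
next
  fix K assume "\<forall>U\<in>K. prob_open M U"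
  then have K: "\<And>U. U \<in> K \<Longrightarrow> prob_open M U" by blast
  show "prob_open M (\<Union>K)"
    unfolding prob_open_def
  proof (intro conjI ballI)
    show "\<Union>K \<subseteq> L0_plus M" using K by (auto simp: prob_open_def)
    fix X assume "X \<in> \<Union>K"
    then obtain U where U: "U \<in> K" "X \<in> U" by blast
    then obtain e where "e > 0" "\<And>Y. Y \<in> L0_plus M \<Longrightarrow>
        measure M {\<omega>\<in>space M. \<bar>Y \<omega> - X \<omega>\<bar> > e} < e \<Longrightarrow> Y \<in> U"
      using K[OF U(1)] unfolding prob_open_def by blast
    then show "\<exists>e>0. \<forall>Y\<in>L0_plus M.
        measure M {\<omega>\<in>space M. \<bar>Y \<omega> - X \<omega>\<bar> > e} < e \<longrightarrow> Y \<in> \<Union>K"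
      using U(1) by (intro exI[of _ e]) auto
  qed
qed

text \<open>The function type carries no vector space structure in the library.\<close>

definition rv_convex :: "('a \<Rightarrow> real) set \<Rightarrow> bool" where
  "rv_convex S \<longleftrightarrow> (\<forall>Y\<in>S. \<forall>Z\<in>S. \<forall>t\<in>{0..1}. (\<lambda>\<omega>. (1 - t) * Y \<omega> + t * Z \<omega>) \<in> S)"

definition closed_convex_hull :: "'a measure \<Rightarrow> ('a \<Rightarrow> real) set \<Rightarrow> ('a \<Rightarrow> real) set" where
  "closed_convex_hull M S = prob_topology M closure_of (rv_convex hull S)"

text \<open>
  A set closed in \<^term>\<open>prob_topology M\<close> contains all versions of its elements, so being a
  singleton has to be read modulo almost sure equality.
\<close>

definition rv_singleton :: "'a measure \<Rightarrow> ('a \<Rightarrow> real) set \<Rightarrow> bool" where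
  "rv_singleton M S \<longleftrightarrow> (\<exists>Y\<in>S. \<forall>Z\<in>S. AE \<omega> in M. Z \<omega> = Y \<omega>)"

definition rv_sigma :: "'a measure \<Rightarrow> ('a \<Rightarrow> real) set \<Rightarrow> 'a set set" where
  "rv_sigma M S = sigma_sets (space M) {Z -` A \<inter> space M | Z A. Z \<in> S \<and> A \<in> sets borel}"

definition continuous_cdf :: "'a measure \<Rightarrow> ('a \<Rightarrow> real) \<Rightarrow> bool" where
  "continuous_cdf M U \<longleftrightarrow> continuous_on UNIV (cdf (distr M borel U))"


definition feasible ::
  "'a measure \<Rightarrow> ('a \<Rightarrow> real) set \<Rightarrow> ('a \<Rightarrow> real) set \<Rightarrow> real \<Rightarrow> ('a \<Rightarrow> real) set" where
  "feasible M T \<H> x = {X \<in> T. \<forall>H\<in>\<H>. expect M (\<lambda>\<omega>. H \<omega> * X \<omega>) \<le> ennreal x}"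

definition worst_power :: "'a measure \<Rightarrow> ('a \<Rightarrow> real) set \<Rightarrow> ('a \<Rightarrow> real) \<Rightarrow> ennreal" where
  "worst_power M \<G> X = (INF G\<in>\<G>. expect M (\<lambda>\<omega>. G \<omega> * X \<omega>))"

text \<open>
  If \<open>\<G>\<close> is nonempty with bounded expectations, the value functions are finite, so that they
  may be passed to \<^term>\<open>enn2real\<close> without loss. For \<open>\<G> = {}\<close> they are constantly infinite.
\<close>

definition V ::
  "'a measure \<Rightarrow> ('a \<Rightarrow> real) set \<Rightarrow> ('a \<Rightarrow> real) set \<Rightarrow> real \<Rightarrow> ennreal" where
  "V M \<G> \<H> x = (SUP X\<in>feasible M (randomized_tests M) \<H> x. worst_power M \<G> X)"

definition V1 ::
  "'a measure \<Rightarrow> ('a \<Rightarrow> real) set \<Rightarrow> ('a \<Rightarrow> real) set \<Rightarrow> real \<Rightarrow> ennreal" where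
  "V1 M \<G> \<H> x = (SUP X\<in>feasible M (pure_tests M) \<H> x. worst_power M \<G> X)"

definition solves_V ::
  "'a measure \<Rightarrow> ('a \<Rightarrow> real) set \<Rightarrow> ('a \<Rightarrow> real) set \<Rightarrow> real \<Rightarrow> ('a \<Rightarrow> real) \<Rightarrow> bool" where
  "solves_V M \<G> \<H> x X \<longleftrightarrow>
     X \<in> feasible M (randomized_tests M) \<H> x \<and> worst_power M \<G> X = V M \<G> \<H> x"

definition solves_V1 ::
  "'a measure \<Rightarrow> ('a \<Rightarrow> real) set \<Rightarrow> ('a \<Rightarrow> real) set \<Rightarrow> real \<Rightarrow> ('a \<Rightarrow> real) \<Rightarrow> bool" where
  "solves_V1 M \<G> \<H> x X \<longleftrightarrow>
     X \<in> feasible M (pure_tests M) \<H> x \<and> worst_power M \<G> X = V1 M \<G> \<H> x"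

definition optimal_triplet ::
  "'a measure \<Rightarrow> ('a \<Rightarrow> real) set \<Rightarrow> ('a \<Rightarrow> real) set \<Rightarrow> real
     \<Rightarrow> ('a \<Rightarrow> real) \<Rightarrow> ('a \<Rightarrow> real) \<Rightarrow> real \<Rightarrow> bool" where
  "optimal_triplet M \<G> \<H> x G' H' a \<longleftrightarrow>
     G' \<in> \<G> \<and> H' \<in> closed_convex_hull M \<H> \<and> 0 \<le> a \<and>
     (\<exists>X'\<in>feasible M (randomized_tests M) \<H> x.
        (\<exists>B\<in>randomized_tests M. \<forall>\<omega>\<in>space M.
           X' \<omega> = of_bool (G' \<omega> > a * H' \<omega>) + B \<omega> * of_bool (G' \<omega> = a * H' \<omega>)) \<and>
        (\<forall>H\<in>\<H>. expect M (\<lambda>\<omega>. H \<omega> * X' \<omega>) \<le> expect M (\<lambda>\<omega>. H' \<omega> * X' \<omega>)) \<and>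
        expect M (\<lambda>\<omega>. H' \<omega> * X' \<omega>) = ennreal x \<and>
        (\<forall>G\<in>\<G>. expect M (\<lambda>\<omega>. G' \<omega> * X' \<omega>) \<le> expect M (\<lambda>\<omega>. G \<omega> * X' \<omega>)))"

definition condition_C1 :: "'a measure \<Rightarrow> ('a \<Rightarrow> real) set \<Rightarrow> ('a \<Rightarrow> real) set \<Rightarrow> bool" where
  "condition_C1 M \<G> \<H> \<longleftrightarrow> rv_singleton M \<G> \<and> rv_singleton M \<H> \<and>
     (\<exists>U\<in>borel_measurable M. continuous_cdf M U)"

definition condition_C2 :: "'a measure \<Rightarrow> ('a \<Rightarrow> real) set \<Rightarrow> ('a \<Rightarrow> real) set \<Rightarrow> bool" where
  "condition_C2 M \<G> \<H> \<longleftrightarrow>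
     (\<exists>U\<in>borel_measurable M. continuous_cdf M U \<and>
        prob_space.indep_set M (rv_sigma M {U}) (rv_sigma M (\<G> \<union> \<H>)))"

definition condition_C3 :: "'a measure \<Rightarrow> ('a \<Rightarrow> real) set \<Rightarrow> ('a \<Rightarrow> real) set \<Rightarrow> bool" where
  "condition_C3 M \<G> \<H> \<longleftrightarrow>
     (\<forall>x. 0 < x \<and> ennreal x < (SUP H\<in>\<H>. expect M H) \<longrightarrow>
        (\<exists>G' H' a. optimal_triplet M \<G> \<H> x G' H' a \<and>
           measure M {\<omega>\<in>space M. G' \<omega> = a * H' \<omega>} = 0))"

end

theory Submission
  imports Defs
begin

text \<open>
  Everything reduces to finding, for each \<open>x\<close>, a pure test that is optimal among randomized ones.
  Concavity of the value function then comes from mixing two optimal tests, and a finite concave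
  function on an open interval is continuous.

  Under (C1), the Neyman-Pearson threshold \<open>a\<close> is found directly, and the tie set \<open>{G = a H}\<close> is cut
  by a level set of the continuously distributed variable so that the size is exactly \<open>x\<close>.
  Under (C2), an optimal randomized test exists by a compactness argument, and replacing it by
  \<open>{F(U) \<le> E[X | \<sigma>(\<G> \<union> \<H>)]}\<close>, where \<open>F\<close> is the distribution function of \<open>U\<close>, changes no expectation
  in question. Under (C3), the triplet provides a test that is pure up to a null set; its optimality
  is the Neyman-Pearson inequality, since by Fatou's lemma the size constraint extends to the closed
  convex hull of \<open>\<H>\<close>.
\<close>

section \<open>Tests and their expectations\<close>

lemma L0_plusD:
  assumes "Z \<in> L0_plus M"
  shows "Z \<in> borel_measurable M" and "\<omega> \<in> space M \<Longrightarrow> 0 \<le> Z \<omega>"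
  using assms by (auto simp: L0_plus_def)

lemma randomized_testsD:
  assumes "X \<in> randomized_tests M"
  shows "X \<in> borel_measurable M" and "\<omega> \<in> space M \<Longrightarrow> 0 \<le> X \<omega>" and "\<omega> \<in> space M \<Longrightarrow> X \<omega> \<le> 1"
  using assms by (auto simp: randomized_tests_def)

lemma pure_tests_subset: "pure_tests M \<subseteq> randomized_tests M"
  by (force simp: pure_tests_def randomized_tests_def)

lemma feasible_pure_subset:
  "feasible M (pure_tests M) \<H> x \<subseteq> feasible M (randomized_tests M) \<H> x"
  using pure_tests_subset by (auto simp: feasible_def)

lemma indicator_pure_test: "A \<in> sets M \<Longrightarrow> indicator A \<in> pure_tests M"
  by (auto simp: pure_tests_def indicator_def)

lemma randomized_tests_convex:
  assumes "X \<in> randomized_tests M" "Y \<in> randomized_tests M" "0 \<le> t" "t \<le> 1"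
  shows "(\<lambda>\<omega>. (1 - t) * X \<omega> + t * Y \<omega>) \<in> randomized_tests M"
  using assms by (auto simp: randomized_tests_def convex_bound_le)

lemma ennreal_convex_comb:
  assumes "0 \<le> t" "t \<le> 1" "0 \<le> p" "0 \<le> q"
  shows "ennreal ((1 - t) * p + t * q) = ennreal (1 - t) * ennreal p + ennreal t * ennreal q"
  using assms by (simp add: ennreal_mult)

lemma expect_convex_comb_right:
  assumes "Z \<in> L0_plus M" "X \<in> randomized_tests M" "Y \<in> randomized_tests M" "0 \<le> t" "t \<le> 1"
  shows "expect M (\<lambda>\<omega>. Z \<omega> * ((1 - t) * X \<omega> + t * Y \<omega>)) =
    ennreal (1 - t) * expect M (\<lambda>\<omega>. Z \<omega> * X \<omega>) + ennreal t * expect M (\<lambda>\<omega>. Z \<omega> * Y \<omega>)"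
proof -
  note [measurable] = L0_plusD(1)[OF assms(1)] randomized_testsD(1)[OF assms(2)]
    randomized_testsD(1)[OF assms(3)]
  have "expect M (\<lambda>\<omega>. Z \<omega> * ((1 - t) * X \<omega> + t * Y \<omega>)) =
    (\<integral>\<^sup>+\<omega>. ennreal (1 - t) * ennreal (Z \<omega> * X \<omega>) + ennreal t * ennreal (Z \<omega> * Y \<omega>) \<partial>M)"
    unfolding expect_def
  proof (rule nn_integral_cong)
    fix \<omega> assume "\<omega> \<in> space M"
    then have "0 \<le> Z \<omega> * X \<omega>" "0 \<le> Z \<omega> * Y \<omega>"
      using assms by (auto simp: L0_plus_def randomized_tests_def)
    then show "ennreal (Z \<omega> * ((1 - t) * X \<omega> + t * Y \<omega>)) =
      ennreal (1 - t) * ennreal (Z \<omega> * X \<omega>) + ennreal t * ennreal (Z \<omega> * Y \<omega>)"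
      by (subst ennreal_convex_comb[OF assms(4,5), symmetric]) (simp_all add: algebra_simps)
  qed
  also have "\<dots> = ennreal (1 - t) * expect M (\<lambda>\<omega>. Z \<omega> * X \<omega>) + ennreal t * expect M (\<lambda>\<omega>. Z \<omega> * Y \<omega>)"
    unfolding expect_def by (simp add: nn_integral_add nn_integral_cmult)
  finally show ?thesis .
qed

text \<open>Each size is affine in the test, so the level may be mixed along with the tests.
  Distinct levels serve concavity of the value function; for equal levels this is convexity of the
  feasible set, used in the existence proof.\<close>

lemma feasible_convex_comb:
  assumes \<H>: "\<H> \<subseteq> L0_plus M" and t: "0 \<le> t" "t \<le> 1" and xy: "0 \<le> x" "0 \<le> y"
    and X: "X \<in> feasible M (randomized_tests M) \<H> x"
    and Y: "Y \<in> feasible M (randomized_tests M) \<H> y"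
  shows "(\<lambda>\<omega>. (1 - t) * X \<omega> + t * Y \<omega>)
    \<in> feasible M (randomized_tests M) \<H> ((1 - t) * x + t * y)"
proof -
  have XY: "X \<in> randomized_tests M" "Y \<in> randomized_tests M"
    using X Y by (auto simp: feasible_def)
  have "expect M (\<lambda>\<omega>. H \<omega> * ((1 - t) * X \<omega> + t * Y \<omega>)) \<le> ennreal ((1 - t) * x + t * y)"
    if "H \<in> \<H>" for H
  proof -
    have "expect M (\<lambda>\<omega>. H \<omega> * ((1 - t) * X \<omega> + t * Y \<omega>)) =
      ennreal (1 - t) * expect M (\<lambda>\<omega>. H \<omega> * X \<omega>) + ennreal t * expect M (\<lambda>\<omega>. H \<omega> * Y \<omega>)"
      using expect_convex_comb_right[OF _ XY t] \<H> that by blast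
    also have "\<dots> \<le> ennreal (1 - t) * ennreal x + ennreal t * ennreal y"
      using X Y that by (intro add_mono mult_left_mono) (auto simp: feasible_def)
    finally show ?thesis
      using t xy by (simp add: ennreal_mult)
  qed
  then show ?thesis
    using randomized_tests_convex[OF XY t] by (simp add: feasible_def)
qed

text \<open>For each fixed \<open>G\<close> the power is affine in the test, and an infimum of
  affine functions is concave.\<close>

lemma worst_power_concave:
  assumes \<G>: "\<G> \<subseteq> L0_plus M" and t: "0 \<le> t" "t \<le> 1"
    and X: "X \<in> randomized_tests M" and Y: "Y \<in> randomized_tests M"
  shows "ennreal (1 - t) * worst_power M \<G> X + ennreal t * worst_power M \<G> Y
    \<le> worst_power M \<G> (\<lambda>\<omega>. (1 - t) * X \<omega> + t * Y \<omega>)"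
  unfolding worst_power_def
proof (rule INF_greatest)
  fix G assume "G \<in> \<G>"
  then show "ennreal (1 - t) * (INF G\<in>\<G>. expect M (\<lambda>\<omega>. G \<omega> * X \<omega>)) +
      ennreal t * (INF G\<in>\<G>. expect M (\<lambda>\<omega>. G \<omega> * Y \<omega>))
    \<le> expect M (\<lambda>\<omega>. G \<omega> * ((1 - t) * X \<omega> + t * Y \<omega>))"
    using \<G> by (subst expect_convex_comb_right[OF _ X Y t])
      (auto intro!: add_mono mult_left_mono INF_lower)
qed

lemma expect_times_test_le:
  assumes "Z \<in> L0_plus M" "X \<in> randomized_tests M"
  shows "expect M (\<lambda>\<omega>. Z \<omega> * X \<omega>) \<le> expect M Z"
  unfolding expect_def
  by (intro nn_integral_mono ennreal_leI mult_left_le)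
    (use assms in \<open>auto simp: L0_plus_def randomized_tests_def\<close>)

text \<open>Dominated convergence with \<open>Z\<close> itself as majorant, since tests are bounded
  by 1.\<close>

lemma expect_tendsto_tests:
  assumes Z: "Z \<in> L0_plus M" "expect M Z < \<top>"
    and Xs: "\<And>n. Xs n \<in> randomized_tests M" and X: "X \<in> randomized_tests M"
    and lim: "AE \<omega> in M. (\<lambda>n. Xs n \<omega>) \<longlonglongrightarrow> X \<omega>"
  shows "(\<lambda>n. expect M (\<lambda>\<omega>. Z \<omega> * Xs n \<omega>)) \<longlonglongrightarrow> expect M (\<lambda>\<omega>. Z \<omega> * X \<omega>)"
  unfolding expect_def
proof (rule nn_integral_dominated_convergence)
  note [measurable] = L0_plusD(1)[OF Z(1)] randomized_testsD(1)[OF X] randomized_testsD(1)[OF Xs]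
  show "(\<lambda>\<omega>. ennreal (Z \<omega> * Xs i \<omega>)) \<in> borel_measurable M" for i by measurable
  show "(\<lambda>\<omega>. ennreal (Z \<omega> * X \<omega>)) \<in> borel_measurable M" by measurable
  show "(\<lambda>\<omega>. ennreal (Z \<omega>)) \<in> borel_measurable M" by measurable
  show "AE \<omega> in M. ennreal (Z \<omega> * Xs j \<omega>) \<le> ennreal (Z \<omega>)" for j
    using L0_plusD(2)[OF Z(1)] randomized_testsD(2,3)[OF Xs]
    by (auto intro!: AE_I2 ennreal_leI mult_left_le)
  show "(\<integral>\<^sup>+\<omega>. ennreal (Z \<omega>) \<partial>M) < \<infinity>" using Z(2) by (simp add: expect_def)
  show "AE \<omega> in M. (\<lambda>i. ennreal (Z \<omega> * Xs i \<omega>)) \<longlonglongrightarrow> ennreal (Z \<omega> * X \<omega>)"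
    using lim by eventually_elim (intro tendsto_ennrealI tendsto_mult tendsto_const)
qed

text \<open>Integrates the pointwise inequality \<open>(G - a H) (X' - X) \<ge> 0\<close>, rearranged so that no
  \<^typ>\<open>ennreal\<close> subtraction occurs.\<close>

lemma likelihood_ratio_test_optimal:
  assumes G: "G \<in> L0_plus M" and H: "H \<in> L0_plus M" and a: "0 \<le> a"
    and X: "X \<in> randomized_tests M" and X': "X' \<in> randomized_tests M"
    and ratio: "AE \<omega> in M. (a * H \<omega> < G \<omega> \<longrightarrow> X' \<omega> = 1) \<and> (G \<omega> < a * H \<omega> \<longrightarrow> X' \<omega> = 0)"
    and size: "expect M (\<lambda>\<omega>. H \<omega> * X \<omega>) \<le> expect M (\<lambda>\<omega>. H \<omega> * X' \<omega>)"
    and fin: "expect M (\<lambda>\<omega>. H \<omega> * X' \<omega>) < \<top>"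
  shows "expect M (\<lambda>\<omega>. G \<omega> * X \<omega>) \<le> expect M (\<lambda>\<omega>. G \<omega> * X' \<omega>)"
proof -
  note [measurable] = L0_plusD(1)[OF G] L0_plusD(1)[OF H] randomized_testsD(1)[OF X]
    randomized_testsD(1)[OF X']
  have split: "(\<integral>\<^sup>+\<omega>. ennreal (G \<omega> * Y \<omega>) + ennreal a * ennreal (H \<omega> * Y' \<omega>) \<partial>M) =
      expect M (\<lambda>\<omega>. G \<omega> * Y \<omega>) + ennreal a * expect M (\<lambda>\<omega>. H \<omega> * Y' \<omega>)"
    if [measurable]: "Y \<in> borel_measurable M" "Y' \<in> borel_measurable M" for Y Y'
    unfolding expect_def by (simp add: nn_integral_add nn_integral_cmult)
  have "expect M (\<lambda>\<omega>. G \<omega> * X \<omega>) + ennreal a * expect M (\<lambda>\<omega>. H \<omega> * X' \<omega>)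
      \<le> expect M (\<lambda>\<omega>. G \<omega> * X' \<omega>) + ennreal a * expect M (\<lambda>\<omega>. H \<omega> * X \<omega>)"
    unfolding split[symmetric, OF randomized_testsD(1)[OF X] randomized_testsD(1)[OF X']]
      split[symmetric, OF randomized_testsD(1)[OF X'] randomized_testsD(1)[OF X]]
  proof (rule nn_integral_mono_AE)
    show "AE \<omega> in M. ennreal (G \<omega> * X \<omega>) + ennreal a * ennreal (H \<omega> * X' \<omega>)
        \<le> ennreal (G \<omega> * X' \<omega>) + ennreal a * ennreal (H \<omega> * X \<omega>)"
      using ratio AE_space
    proof eventually_elim
      fix \<omega> assume r: "(a * H \<omega> < G \<omega> \<longrightarrow> X' \<omega> = 1) \<and> (G \<omega> < a * H \<omega> \<longrightarrow> X' \<omega> = 0)"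
        and \<omega>: "\<omega> \<in> space M"
      note bds = L0_plusD(2)[OF G \<omega>] L0_plusD(2)[OF H \<omega>] randomized_testsD(2,3)[OF X \<omega>]
        randomized_testsD(2,3)[OF X' \<omega>]
      have "0 \<le> (G \<omega> - a * H \<omega>) * (X' \<omega> - X \<omega>)"
        using r bds by (cases "a * H \<omega>" "G \<omega>" rule: linorder_cases)
          (auto simp: mult_nonneg_nonneg mult_nonpos_nonneg)
      then have "G \<omega> * X \<omega> + a * (H \<omega> * X' \<omega>) \<le> G \<omega> * X' \<omega> + a * (H \<omega> * X \<omega>)"
        by (simp add: algebra_simps)
      then show "ennreal (G \<omega> * X \<omega>) + ennreal a * ennreal (H \<omega> * X' \<omega>)
          \<le> ennreal (G \<omega> * X' \<omega>) + ennreal a * ennreal (H \<omega> * X \<omega>)"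
        using bds a by (simp add: ennreal_mult[symmetric] ennreal_plus[symmetric] ennreal_leI
            del: ennreal_plus)
    qed
  qed
  \<comment> \<open>Replacing \<open>X\<close> by \<open>X'\<close> in the size term leaves the same
    summand on both sides; it is finite by \<open>fin\<close> and so may be cancelled in
    \<open>ennreal\<close>.\<close>
  also have "\<dots> \<le> expect M (\<lambda>\<omega>. G \<omega> * X' \<omega>) + ennreal a * expect M (\<lambda>\<omega>. H \<omega> * X' \<omega>)"
    using size by (intro add_mono mult_left_mono) auto
  finally show ?thesis
    using fin by (auto simp: ennreal_add_left_cancel_le ennreal_mult_eq_top_iff add.commute)
qed

text \<open>Conditional expectation takes a sigma-algebra in the form of a measure; the one here has
  \<open>rv_sigma M S\<close> as its measurable sets.\<close>

lemma rv_sigma_measurable: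
  fixes Z :: "'a \<Rightarrow> real"
  assumes "Z \<in> S"
  shows "Z \<in> borel_measurable (sigma (space M) {Z -` A \<inter> space M | Z A. Z \<in> S \<and> A \<in> sets borel})"
proof (rule measurableI)
  fix A :: "real set" assume "A \<in> sets borel"
  then have "Z -` A \<inter> space M \<in> {Z -` A \<inter> space M | Z A. Z \<in> S \<and> A \<in> sets borel}"
    using assms by blast
  then show "Z -` A \<inter> space (sigma (space M) {Z -` A \<inter> space M | Z A. Z \<in> S \<and> A \<in> sets borel})
      \<in> sets (sigma (space M) {Z -` A \<inter> space M | Z A. Z \<in> S \<and> A \<in> sets borel})"
    by (auto simp: space_measure_of_conv intro!: in_measure_of)
qed simp

section \<open>Regularity of the value functions\<close>

text \<open>A mixture of two pure tests is in general not pure, so concavity is obtained through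
  \<open>V\<close>: the mixture competes in \<open>V\<close> at the intermediate level, where
  \<open>V\<close> and \<open>V1\<close> agree. Continuity follows from concavity, and monotonicity
  from inclusion of the feasible sets.\<close>

lemma V1_properties_if_pure_optimal:
  assumes \<G>: "\<G> \<subseteq> L0_plus M" "\<And>G. G \<in> \<G> \<Longrightarrow> expect M G < \<top>"
    and \<H>: "\<H> \<subseteq> L0_plus M"
    and opt: "\<And>x. 0 < x \<Longrightarrow> \<exists>X'\<in>feasible M (pure_tests M) \<H> x.
      \<forall>X\<in>feasible M (randomized_tests M) \<H> x. worst_power M \<G> X \<le> worst_power M \<G> X'"
  shows "(\<forall>x>0. V1 M \<G> \<H> x = V M \<G> \<H> x \<and>
            (\<exists>X'\<in>pure_tests M. solves_V M \<G> \<H> x X' \<and> solves_V1 M \<G> \<H> x X')) \<and>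
         continuous_on {0<..} (V1 M \<G> \<H>) \<and>
         concave_on {0<..} (\<lambda>x. enn2real (V1 M \<G> \<H> x)) \<and>
         mono_on {0<..} (V1 M \<G> \<H>)"
proof -
  have sol: "\<exists>X'\<in>feasible M (pure_tests M) \<H> x. V M \<G> \<H> x = worst_power M \<G> X' \<and>
      V1 M \<G> \<H> x = worst_power M \<G> X'" if x: "0 < x" for x
  proof -
    obtain X' where X': "X' \<in> feasible M (pure_tests M) \<H> x"
      "\<And>X. X \<in> feasible M (randomized_tests M) \<H> x \<Longrightarrow> worst_power M \<G> X \<le> worst_power M \<G> X'"
      using opt[OF x] by blast
    have "V1 M \<G> \<H> x \<le> V M \<G> \<H> x"
      unfolding V_def V1_def by (rule SUP_subset_mono[OF feasible_pure_subset]) simp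
    moreover have "V M \<G> \<H> x \<le> worst_power M \<G> X'"
      unfolding V_def by (rule SUP_least[OF X'(2)])
    moreover have "worst_power M \<G> X' \<le> V1 M \<G> \<H> x"
      unfolding V1_def by (rule SUP_upper[OF X'(1)])
    ultimately show ?thesis using X'(1) by (auto intro!: bexI[of _ X'])
  qed
  have part1: "\<forall>x>0. V1 M \<G> \<H> x = V M \<G> \<H> x \<and>
      (\<exists>X'\<in>pure_tests M. solves_V M \<G> \<H> x X' \<and> solves_V1 M \<G> \<H> x X')"
  proof (intro allI impI)
    fix x :: real assume "0 < x"
    from sol[OF this] obtain X' where X': "X' \<in> feasible M (pure_tests M) \<H> x"
      "V M \<G> \<H> x = worst_power M \<G> X'" "V1 M \<G> \<H> x = worst_power M \<G> X'" by blast
    moreover have "X' \<in> pure_tests M" using X'(1) by (simp add: feasible_def)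
    moreover have "X' \<in> feasible M (randomized_tests M) \<H> x" using X'(1) feasible_pure_subset by blast
    ultimately show "V1 M \<G> \<H> x = V M \<G> \<H> x \<and>
        (\<exists>X'\<in>pure_tests M. solves_V M \<G> \<H> x X' \<and> solves_V1 M \<G> \<H> x X')"
      by (auto simp: solves_V_def solves_V1_def)
  qed
  have mono: "mono_on {0<..} (V1 M \<G> \<H>)"
  proof (rule mono_onI)
    fix x y :: real assume "x \<le> y"
    then have "feasible M (pure_tests M) \<H> x \<subseteq> feasible M (pure_tests M) \<H> y"
      by (auto simp: feasible_def intro: order.trans ennreal_leI)
    then show "V1 M \<G> \<H> x \<le> V1 M \<G> \<H> y"
      unfolding V1_def by (rule SUP_subset_mono) simp
  qed
  show ?thesis
  proof (cases "\<G> = {}")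
    case True
    \<comment> \<open>The infimum over the empty set is \<open>\<top>\<close>, so \<open>V1\<close>
      is constant and its image under \<open>enn2real\<close> is the constant 0.\<close>
    then have top: "V1 M \<G> \<H> x = \<top>" if "0 < x" for x
      using sol[OF that] by (auto simp: worst_power_def)
    have "continuous_on {0<..} (V1 M \<G> \<H>) \<longleftrightarrow> continuous_on {0<..} (\<lambda>_::real. \<top>::ennreal)"
      by (rule continuous_on_cong) (simp_all add: top)
    moreover have "concave_on {0<..} (\<lambda>x. enn2real (V1 M \<G> \<H> x))"
      by (rule concave_on_linorderI) (simp_all add: top add_pos_pos)
    ultimately show ?thesis using part1 mono by simp
  next
    case False
    then obtain G where G: "G \<in> \<G>" by blast
    have fin: "V1 M \<G> \<H> x < \<top>" if x: "0 < x" for x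
    proof -
      obtain X' where X': "X' \<in> feasible M (pure_tests M) \<H> x" "V1 M \<G> \<H> x = worst_power M \<G> X'"
        using sol[OF x] by blast
      have "worst_power M \<G> X' \<le> expect M (\<lambda>\<omega>. G \<omega> * X' \<omega>)"
        unfolding worst_power_def by (rule INF_lower[OF G])
      also have "\<dots> \<le> expect M G"
        using X'(1) G \<G>(1) pure_tests_subset by (intro expect_times_test_le) (auto simp: feasible_def)
      finally show ?thesis using X'(2) \<G>(2)[OF G] by simp
    qed
    have concave: "concave_on {0<..} (\<lambda>x. enn2real (V1 M \<G> \<H> x))"
    proof (rule concave_on_linorderI)
      fix t x y :: real assume t: "0 < t" "t < 1" and "x \<in> {0<..}" "y \<in> {0<..}"
      then have x: "0 < x" and y: "0 < y" and t': "0 \<le> t" "t \<le> 1" by auto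
      let ?z = "(1 - t) * x + t * y"
      have z: "0 < ?z" using t x y by (simp add: add_pos_pos)
      obtain X Y where X: "X \<in> feasible M (pure_tests M) \<H> x" "V1 M \<G> \<H> x = worst_power M \<G> X"
        and Y: "Y \<in> feasible M (pure_tests M) \<H> y" "V1 M \<G> \<H> y = worst_power M \<G> Y"
        using sol[OF x] sol[OF y] by blast
      let ?Z = "\<lambda>\<omega>. (1 - t) * X \<omega> + t * Y \<omega>"
      have "?Z \<in> feasible M (randomized_tests M) \<H> ?z"
        using X Y x y feasible_pure_subset by (intro feasible_convex_comb[OF \<H> t']) auto
      then have "worst_power M \<G> ?Z \<le> V M \<G> \<H> ?z"
        unfolding V_def by (rule SUP_upper)
      moreover have "ennreal (1 - t) * worst_power M \<G> X + ennreal t * worst_power M \<G> Y \<le> worst_power M \<G> ?Z"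
        using X Y pure_tests_subset by (intro worst_power_concave[OF \<G>(1) t']) (auto simp: feasible_def)
      ultimately have le: "ennreal (1 - t) * V1 M \<G> \<H> x + ennreal t * V1 M \<G> \<H> y \<le> V1 M \<G> \<H> ?z"
        unfolding X(2) Y(2) by (subst part1[rule_format, OF z, THEN conjunct1]) (rule order.trans)
      obtain u v w where uvw: "V1 M \<G> \<H> x = ennreal u" "V1 M \<G> \<H> y = ennreal v" "V1 M \<G> \<H> ?z = ennreal w"
        "0 \<le> u" "0 \<le> v" "0 \<le> w"
        using fin[OF x] fin[OF y] fin[OF z]
        by (cases "V1 M \<G> \<H> x"; cases "V1 M \<G> \<H> y"; cases "V1 M \<G> \<H> ?z") auto
      have "ennreal ((1 - t) * u + t * v) \<le> ennreal w"
        using le unfolding uvw(1-3) ennreal_convex_comb[OF t' uvw(4,5)] .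
      then show "(1 - t) * enn2real (V1 M \<G> \<H> x) + t * enn2real (V1 M \<G> \<H> y)
          \<le> enn2real (V1 M \<G> \<H> ((1 - t) *\<^sub>R x + t *\<^sub>R y))"
        using uvw by simp
    qed simp
    \<comment> \<open>A convex real function on an open interval is continuous. Finiteness of
      \<open>V1\<close> lets this be carried back to \<open>ennreal\<close>.\<close>
    have "continuous_on {0<..} (\<lambda>x. - enn2real (V1 M \<G> \<H> x))"
      using concave unfolding concave_on_def by (intro convex_on_continuous) auto
    then have "continuous_on {0<..} (\<lambda>x. - (- enn2real (V1 M \<G> \<H> x)))"
      by (rule continuous_on_minus)
    then have "continuous_on {0<..} (\<lambda>x. ennreal (enn2real (V1 M \<G> \<H> x)))"
      by (intro continuous_on_ennreal) simp
    moreover have "ennreal (enn2real (V1 M \<G> \<H> x)) = V1 M \<G> \<H> x" if "x \<in> {0<..}" for x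
      using fin[of x] that by simp
    ultimately have "continuous_on {0<..} (V1 M \<G> \<H>)"
      by (rule continuous_on_eq)
    then show ?thesis using part1 mono concave by blast
  qed
qed

section \<open>The probability integral transform\<close>

text \<open>A continuous distribution function, evaluated at a variable with that law, is uniform on
  [0,1]. Its sublevel set is a closed half-line at whose endpoint the value is exactly
  \<open>z\<close>, apart from the extreme cases where the set is empty or the whole line.\<close>

lemma (in real_distribution) measure_cdf_le:
  assumes cont: "continuous_on UNIV (cdf M)" and z: "0 \<le> z" "z \<le> 1"
  shows "measure M {u. cdf M u \<le> z} = z"
proof (cases "z = 1")
  case True
  then have "{u. cdf M u \<le> z} = space M" using cdf_bounded_prob by auto
  then show ?thesis using True prob_space by simp
next
  case False
  let ?A = "{u. cdf M u \<le> z}"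
  \<comment> \<open>Boundedness from above rests on \<open>z < 1\<close>, which is why
    \<open>z = 1\<close> is split off.\<close>
  have "eventually (\<lambda>u. z < cdf M u) at_top"
    using order_tendstoD(1)[OF cdf_lim_at_top_prob] z False by auto
  then obtain b where b: "\<And>u. b \<le> u \<Longrightarrow> z < cdf M u"
    by (auto simp: eventually_at_top_linorder)
  have bdd: "bdd_above ?A"
  proof (rule bdd_aboveI[of _ b])
    fix u assume "u \<in> ?A"
    then show "u \<le> b" using b[of u] by (cases "b \<le> u") auto
  qed
  have closed: "closed ?A"
    by (intro closed_Collect_le cont continuous_on_const)
  show ?thesis
  proof (cases "?A = {}")
    case True
    have "z = 0"
    proof (rule ccontr)
      assume "z \<noteq> 0"
      then have "eventually (\<lambda>u. cdf M u < z) at_bot"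
        using order_tendstoD(2)[OF cdf_lim_at_bot] z by auto
      then obtain u where "cdf M u < z"
        by (auto simp: eventually_at_bot_linorder)
      then show False using True by (auto intro: less_imp_le)
    qed
    then show ?thesis using True by (metis measure_empty)
  next
    case ne: False
    let ?s = "Sup ?A"
    have s: "cdf M ?s \<le> z"
      using closed_contains_Sup[OF ne bdd closed] by simp
    have A: "?A = {..?s}"
    proof (intro equalityI subsetI)
      fix u assume "u \<in> ?A" then show "u \<in> {..?s}" using cSup_upper[OF _ bdd] by simp
    next
      fix u assume "u \<in> {..?s}"
      then show "u \<in> ?A" using cdf_nondecreasing[of u ?s] s by simp
    qed
    \<comment> \<open>Otherwise continuity would put points to the right of \<open>?s\<close> into
      the sublevel set.\<close>
    have "\<not> cdf M ?s < z"
    proof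
      assume "cdf M ?s < z"
      moreover have "isCont (cdf M) ?s" using cont by (simp add: continuous_on_eq_continuous_at)
      ultimately have "eventually (\<lambda>u. cdf M u < z) (at ?s)"
        by (intro order_tendstoD(2)) (auto simp: isCont_def)
      then obtain d where d: "d > 0" "\<And>u. u \<noteq> ?s \<Longrightarrow> dist u ?s < d \<Longrightarrow> cdf M u < z"
        unfolding eventually_at by auto
      have "cdf M (?s + d / 2) < z" using d by (intro d(2)) (auto simp: dist_real_def)
      then have "?s + d / 2 \<in> {..?s}" unfolding A[symmetric] by simp
      then show False using d(1) by simp
    qed
    then show ?thesis using s A by (simp add: cdf_def)
  qed
qed

context prob_space
begin

section \<open>Convergence in probability and the closed convex hull\<close>

lemma openin_prob_topology: "openin (prob_topology M) = prob_open M"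
  unfolding prob_topology_def
  by (rule topology_inverse'[OF istopology_prob_open]) unfold_locales

lemma topspace_prob_topology: "topspace (prob_topology M) = L0_plus M"
proof
  have "prob_open M (L0_plus M)"
    by (auto simp: prob_open_def intro: exI[of _ 1])
  then show "L0_plus M \<subseteq> topspace (prob_topology M)"
    unfolding topspace_def openin_prob_topology by blast
  show "topspace (prob_topology M) \<subseteq> L0_plus M"
    unfolding topspace_def openin_prob_topology by (auto simp: prob_open_def)
qed

text \<open>Fatou's lemma. If no neighbourhood of an excluded point \<open>Z\<close> avoided the
  set, members of the set would converge to \<open>Z\<close> almost surely, and the bound would pass
  to \<open>Z\<close>.\<close>

lemma closedin_expect_le:
  assumes X: "X \<in> randomized_tests M"
  shows "closedin (prob_topology M) {Z \<in> L0_plus M. expect M (\<lambda>\<omega>. Z \<omega> * X \<omega>) \<le> c}"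
    (is "closedin _ ?C")
proof -
  have "prob_open M (L0_plus M - ?C)"
    unfolding prob_open_def
  proof (intro conjI ballI)
    fix Z assume "Z \<in> L0_plus M - ?C"
    then have Z: "Z \<in> L0_plus M" and gt: "\<not> expect M (\<lambda>\<omega>. Z \<omega> * X \<omega>) \<le> c" by auto
    show "\<exists>e>0. \<forall>Y\<in>L0_plus M. measure M {\<omega>\<in>space M. e < \<bar>Y \<omega> - Z \<omega>\<bar>} < e \<longrightarrow> Y \<in> L0_plus M - ?C"
    proof (rule ccontr)
      assume neg: "\<not> ?thesis"
      \<comment> \<open>The radii \<open>(1/2)^n\<close> are summable, so the Borel-Cantelli lemma
        gives almost sure convergence of the whole sequence, with no passage to a
        subsequence.\<close>
      have "\<forall>n::nat. \<exists>Y. Y \<in> ?C \<and> measure M {\<omega>\<in>space M. (1/2)^n < \<bar>Y \<omega> - Z \<omega>\<bar>} < (1/2)^n"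
      proof
        fix n :: nat
        have "(0::real) < (1/2)^n" by simp
        then obtain Y where "Y \<in> L0_plus M" "measure M {\<omega>\<in>space M. (1/2)^n < \<bar>Y \<omega> - Z \<omega>\<bar>} < (1/2)^n"
          "Y \<notin> L0_plus M - ?C"
          using neg by blast
        then show "\<exists>Y. Y \<in> ?C \<and> measure M {\<omega>\<in>space M. (1/2)^n < \<bar>Y \<omega> - Z \<omega>\<bar>} < (1/2)^n"
          by blast
      qed
      from choice[OF this] obtain Y where Y: "\<And>n. Y n \<in> ?C"
        and close: "\<And>n::nat. measure M {\<omega>\<in>space M. (1/2)^n < \<bar>Y n \<omega> - Z \<omega>\<bar>} < (1/2)^n"
        by blast
      have [measurable]: "Y n \<in> borel_measurable M" for n
        using Y by (auto simp: L0_plus_def)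
      note [measurable] = L0_plusD(1)[OF Z] randomized_testsD(1)[OF X]
      have "AE \<omega> in M. eventually (\<lambda>n. \<omega> \<in> space M - {\<omega>\<in>space M. (1/2)^n < \<bar>Y n \<omega> - Z \<omega>\<bar>}) sequentially"
      proof (rule borel_cantelli_AE1)
        show "summable (\<lambda>n. measure M {\<omega>\<in>space M. (1/2)^n < \<bar>Y n \<omega> - Z \<omega>\<bar>})"
        proof (rule summable_comparison_test')
          show "summable (\<lambda>n. (1/2::real)^n)" by (simp add: summable_geometric)
          show "norm (measure M {\<omega>\<in>space M. (1/2)^n < \<bar>Y n \<omega> - Z \<omega>\<bar>}) \<le> (1/2)^n" for n
            using close[of n] by simp
        qed
      qed (auto simp: emeasure_eq_measure)
      then have lim: "AE \<omega> in M. (\<lambda>n. Y n \<omega>) \<longlonglongrightarrow> Z \<omega>"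
      proof eventually_elim
        case (elim \<omega>)
        have "(\<lambda>n. Y n \<omega> - Z \<omega>) \<longlonglongrightarrow> 0"
        proof (rule Lim_null_comparison)
          show "\<forall>\<^sub>F n in sequentially. norm (Y n \<omega> - Z \<omega>) \<le> (1/2)^n"
            using elim by eventually_elim auto
          show "(\<lambda>n. (1/2::real)^n) \<longlonglongrightarrow> 0" by (simp add: LIMSEQ_power_zero)
        qed
        then show ?case by (simp add: LIM_zero_iff)
      qed
      have "expect M (\<lambda>\<omega>. Z \<omega> * X \<omega>) = (\<integral>\<^sup>+\<omega>. liminf (\<lambda>n. ennreal (Y n \<omega> * X \<omega>)) \<partial>M)"
        unfolding expect_def
      proof (rule nn_integral_cong_AE)
        show "AE \<omega> in M. ennreal (Z \<omega> * X \<omega>) = liminf (\<lambda>n. ennreal (Y n \<omega> * X \<omega>))"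
          using lim
        proof eventually_elim
          case (elim \<omega>)
          then have "(\<lambda>n. ennreal (Y n \<omega> * X \<omega>)) \<longlonglongrightarrow> ennreal (Z \<omega> * X \<omega>)"
            by (intro tendsto_ennrealI tendsto_mult tendsto_const)
          then show ?case by (simp add: lim_imp_Liminf)
        qed
      qed
      also have "\<dots> \<le> liminf (\<lambda>n. expect M (\<lambda>\<omega>. Y n \<omega> * X \<omega>))"
        unfolding expect_def by (rule nn_integral_liminf) measurable
      also have "\<dots> \<le> liminf (\<lambda>n. c)"
        using Y by (intro Liminf_mono) auto
      finally show False using gt by (simp add: Liminf_const)
    qed
  qed auto
  then show ?thesis
    by (auto simp: closedin_def openin_prob_topology topspace_prob_topology)
qed

text \<open>The variables satisfying the bound form a convex set, closed by
  \<open>closedin_expect_le\<close>, which therefore contains the closed convex hull along with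
  \<open>\<H>\<close>. This carries the size constraint over to the second component of an optimal
  triplet, which need not lie in \<open>\<H>\<close>.\<close>

lemma expect_closed_convex_hull_le:
  assumes \<H>: "\<H> \<subseteq> L0_plus M" and X: "X \<in> randomized_tests M"
    and le: "\<And>H. H \<in> \<H> \<Longrightarrow> expect M (\<lambda>\<omega>. H \<omega> * X \<omega>) \<le> c"
    and H': "H' \<in> closed_convex_hull M \<H>"
  shows "H' \<in> L0_plus M \<and> expect M (\<lambda>\<omega>. H' \<omega> * X \<omega>) \<le> c"
proof -
  let ?C = "{Z \<in> L0_plus M. expect M (\<lambda>\<omega>. Z \<omega> * X \<omega>) \<le> c}"
  note [measurable] = randomized_testsD(1)[OF X]
  have "rv_convex ?C"
    unfolding rv_convex_def
  proof (intro ballI)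
    fix Y Z and t :: real assume Y: "Y \<in> ?C" and Z: "Z \<in> ?C" and t: "t \<in> {0..1}"
    have [measurable]: "Y \<in> borel_measurable M" "Z \<in> borel_measurable M"
      using Y Z by (auto simp: L0_plus_def)
    have "expect M (\<lambda>\<omega>. ((1 - t) * Y \<omega> + t * Z \<omega>) * X \<omega>) =
      (\<integral>\<^sup>+\<omega>. ennreal (1 - t) * ennreal (Y \<omega> * X \<omega>) + ennreal t * ennreal (Z \<omega> * X \<omega>) \<partial>M)"
      unfolding expect_def
    proof (rule nn_integral_cong)
      fix \<omega> assume "\<omega> \<in> space M"
      then have "0 \<le> Y \<omega> * X \<omega>" "0 \<le> Z \<omega> * X \<omega>"
        using X Y Z by (auto simp: L0_plus_def randomized_tests_def)
      then show "ennreal (((1 - t) * Y \<omega> + t * Z \<omega>) * X \<omega>) =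
        ennreal (1 - t) * ennreal (Y \<omega> * X \<omega>) + ennreal t * ennreal (Z \<omega> * X \<omega>)"
        using t by (subst ennreal_convex_comb[symmetric]) (simp_all add: algebra_simps)
    qed
    also have "\<dots> = ennreal (1 - t) * expect M (\<lambda>\<omega>. Y \<omega> * X \<omega>) + ennreal t * expect M (\<lambda>\<omega>. Z \<omega> * X \<omega>)"
      unfolding expect_def by (simp add: nn_integral_add nn_integral_cmult)
    also have "\<dots> \<le> ennreal (1 - t) * c + ennreal t * c"
      using Y Z by (intro add_mono mult_left_mono) auto
    also have "\<dots> = c"
      using t by (simp add: distrib_right[symmetric] ennreal_plus[symmetric] del: ennreal_plus)
    finally show "(\<lambda>\<omega>. (1 - t) * Y \<omega> + t * Z \<omega>) \<in> ?C"
      using Y Z t by (auto simp: L0_plus_def)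
  qed
  then have "rv_convex hull \<H> \<subseteq> ?C"
    using \<H> le by (intro hull_minimal) auto
  then have "closed_convex_hull M \<H> \<subseteq> ?C"
    unfolding closed_convex_hull_def by (rule closure_of_minimal[OF _ closedin_expect_le[OF X]])
  then show ?thesis using H' by blast
qed

section \<open>Splitting by a continuously distributed variable\<close>

text \<open>The mass of a point is the jump of the distribution function there.\<close>

lemma continuous_cdf_nonatomic:
  assumes "U \<in> borel_measurable M" "continuous_cdf M U"
  shows "AE \<omega> in M. U \<omega> \<noteq> x"
proof -
  interpret D: real_distribution "distr M borel U"
    using assms by (rule_tac real_distribution_distr)
  have "measure (distr M borel U) {x} = 0"
    using assms by (simp add: D.isCont_cdf[symmetric] continuous_cdf_def continuous_on_eq_continuous_at)
  then have "prob (U -` {x} \<inter> space M) = 0"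
    using assms by (simp add: measure_distr)
  then show ?thesis
    using assms by (intro AE_I[of _ _ "U -` {x} \<inter> space M"]) (auto simp: emeasure_eq_measure)
qed

text \<open>The measure with density \<open>f\<close>, transported by \<open>U\<close>, has no
  atoms, so its distribution function is continuous; the intermediate value theorem yields a
  \<open>c\<close> for which the event \<open>U \<le> c\<close> serves as \<open>S\<close>.\<close>

lemma nonatomic_subset_expect:
  assumes f: "f \<in> L0_plus M" "expect M f < \<top>"
    and U: "U \<in> borel_measurable M" "continuous_cdf M U"
    and y: "0 \<le> y" "ennreal y \<le> expect M f"
  obtains S where "S \<in> sets M" "expect M (\<lambda>\<omega>. f \<omega> * indicator S \<omega>) = ennreal y"
proof -
  note [measurable] = L0_plusD(1)[OF f(1)] U(1)
  \<comment> \<open>The end values are attained by the empty set and the whole space. Strictly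
    between them, the limits of the distribution function supply points below and above
    \<open>y\<close>.\<close>
  consider "y = 0" | "ennreal y = expect M f" | "0 < y" "ennreal y < expect M f"
    using y by fastforce
  then show thesis
  proof cases
    case 1
    then show ?thesis using that[of "{}"] by (simp add: expect_def)
  next
    case 2
    then have "expect M (\<lambda>\<omega>. f \<omega> * indicator (space M) \<omega>) = ennreal y"
      by (auto simp: expect_def intro!: nn_integral_cong)
    then show ?thesis using that[of "space M"] by simp
  next
    case 3
    define N where "N = distr (density M (\<lambda>\<omega>. ennreal (f \<omega>))) borel U"
    have eN: "emeasure N A = expect M (\<lambda>\<omega>. f \<omega> * indicator (U -` A \<inter> space M) \<omega>)"
      if [measurable]: "A \<in> sets borel" for A
      unfolding N_def expect_def
      by (subst emeasure_distr) (auto simp: emeasure_density indicator_def intro!: nn_integral_cong)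
    have tot: "emeasure N UNIV = expect M f"
      by (subst eN) (auto simp: expect_def intro!: nn_integral_cong)
    interpret N: finite_borel_measure N
    proof (intro finite_borel_measure.intro finite_borel_measure_axioms.intro finite_measureI)
      show "emeasure N (space N) \<noteq> \<infinity>"
        using f(2) tot by (simp add: N_def)
      show "sets N = sets borel" by (simp add: N_def)
    qed
    \<comment> \<open>A set that is null for \<open>M\<close> stays null under the density, so
      \<open>N\<close> inherits the absence of atoms.\<close>
    have cont: "isCont (cdf N) x" for x
    proof -
      have "emeasure N {x} = (\<integral>\<^sup>+\<omega>. 0 \<partial>M)"
        unfolding eN[OF borel_singleton[OF sets.empty_sets]] expect_def
        using continuous_cdf_nonatomic[OF U, of x]
        by (intro nn_integral_cong_AE) (auto simp: indicator_def)
      then show ?thesis by (simp add: N.isCont_cdf measure_def)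
    qed
    have tot': "measure N (space N) > y"
    proof -
      obtain r where r: "expect M f = ennreal r" "0 \<le> r"
        using f(2) by (cases "expect M f") auto
      then have "measure N (space N) = r"
        using tot by (simp add: measure_def N_def)
      then show ?thesis using 3 r y by (simp add: ennreal_less_iff)
    qed
    obtain hi where hi: "y < cdf N hi"
      using order_tendstoD(1)[OF N.cdf_lim_at_top tot'] by (auto simp: eventually_at_top_linorder)
    obtain lo where lo: "cdf N lo < y"
      using order_tendstoD(2)[OF N.cdf_lim_at_bot 3(1)] by (auto simp: eventually_at_bot_linorder)
    have "lo \<le> hi" using N.cdf_nondecreasing[of hi lo] hi lo by linarith
    then obtain c where c: "cdf N c = y"
      using IVT[of "cdf N" lo y hi] cont hi lo by auto
    have "expect M (\<lambda>\<omega>. f \<omega> * indicator (U -` {..c} \<inter> space M) \<omega>) = ennreal y"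
      using c by (simp add: eN[symmetric] cdf_def N.emeasure_eq_measure)
    then show ?thesis using that[of "U -` {..c} \<inter> space M"] by simp
  qed
qed

text \<open>Conditionally on \<open>F\<close>, the distribution function of \<open>U\<close>
  evaluated at \<open>U\<close> is still uniform, so the event that it is at most \<open>w\<close>,
  a version of the conditional expectation of \<open>X\<close>, has conditional probability
  \<open>w\<close>. Integrals against \<open>F\<close>-measurable variables then agree with those of
  \<open>X\<close>.\<close>

lemma derandomize_independent:
  assumes F: "subalgebra M F"
    and U: "U \<in> borel_measurable M" "continuous_cdf M U"
    and indep: "indep_set (rv_sigma M {U}) (sets F)"
    and X: "X \<in> randomized_tests M"
  obtains X' where "X' \<in> pure_tests M"
    "\<And>Z. Z \<in> borel_measurable F \<Longrightarrow> Z \<in> L0_plus M \<Longrightarrow>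
       expect M (\<lambda>\<omega>. Z \<omega> * X' \<omega>) = expect M (\<lambda>\<omega>. Z \<omega> * X \<omega>)"
proof -
  interpret F: finite_measure_subalgebra M F by standard (rule F)
  let ?D = "distr M borel U"
  interpret D: real_distribution ?D
    using U by (rule_tac real_distribution_distr)
  note [measurable] = U(1) randomized_testsD(1)[OF X]
  define W where "W = nn_cond_exp M F (\<lambda>\<omega>. ennreal (X \<omega>))"
  have W[measurable]: "W \<in> borel_measurable F" unfolding W_def by simp
  \<comment> \<open>A version of \<open>W\<close> with real values in [0,1] everywhere, so that
    \<open>measure_cdf_le\<close> applies at each point.\<close>
  define w where "w = (\<lambda>\<omega>. min 1 (enn2real (W \<omega>)))"
  have w[measurable]: "w \<in> borel_measurable F" unfolding w_def by measurable
  have wM[measurable]: "w \<in> borel_measurable M" by (rule measurable_from_subalg[OF F w])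
  \<comment> \<open>The identity into \<open>F\<close> acts as a random variable carrying all the
    information of \<open>F\<close>; its law is \<open>M\<close> restricted to
    \<open>F\<close>.\<close>
  have [measurable]: "(\<lambda>x. x) \<in> measurable M F"
    using F by (auto simp: subalgebra_def measurable_def)
  have "AE \<omega> in M. W \<omega> \<le> nn_cond_exp M F (\<lambda>_. 1) \<omega>"
    unfolding W_def using randomized_testsD(3)[OF X]
    by (intro F.nn_cond_exp_mono) auto
  moreover have "AE \<omega> in M. 1 = nn_cond_exp M F (\<lambda>_. 1) \<omega>"
    by (rule F.nn_cond_exp_F_meas) simp
  ultimately have wW: "AE \<omega> in M. ennreal (w \<omega>) = W \<omega>"
  proof eventually_elim
    case (elim \<omega>)
    then have "W \<omega> \<le> 1" by simp
    moreover from this have "enn2real (W \<omega>) \<le> 1" "W \<omega> < \<top>"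
      by (auto simp: enn2real_leI intro: le_less_trans)
    ultimately show ?case by (simp add: w_def)
  qed
  have w01: "0 \<le> w \<omega>" "w \<omega> \<le> 1" for \<omega> by (auto simp: w_def)
  have cdfm[measurable]: "cdf ?D \<in> borel_measurable borel"
    using U(2) by (auto simp: continuous_cdf_def intro: borel_measurable_continuous_onI)
  define A where "A = {\<omega>\<in>space M. cdf ?D (U \<omega>) \<le> w \<omega>}"
  have A[measurable]: "A \<in> sets M" unfolding A_def by measurable
  interpret P: prob_space "distr M F (\<lambda>x. x)"
    by (rule prob_space_distr) measurable
  interpret DP: pair_sigma_finite ?D "distr M F (\<lambda>x. x)" ..
  \<comment> \<open>Independence in the form suited to Fubini's theorem: the joint law of
    \<open>U\<close> and that identity is a product measure, checked on rectangles.\<close>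
  have prod: "?D \<Otimes>\<^sub>M distr M F (\<lambda>x. x) = distr M (borel \<Otimes>\<^sub>M F) (\<lambda>\<omega>. (U \<omega>, \<omega>))"
  proof (rule pair_measure_eqI)
    show "sigma_finite_measure ?D" "sigma_finite_measure (distr M F (\<lambda>x. x))" ..
    show "sets (?D \<Otimes>\<^sub>M distr M F (\<lambda>x. x)) = sets (distr M (borel \<Otimes>\<^sub>M F) (\<lambda>\<omega>. (U \<omega>, \<omega>)))"
      by (simp cong: sets_pair_measure_cong)
    fix A B assume "A \<in> sets ?D" "B \<in> sets (distr M F (\<lambda>x. x))"
    then have [measurable]: "A \<in> sets borel" "B \<in> sets F" by auto
    then have B: "B \<in> sets M" "B \<subseteq> space M"
      using F sets.sets_into_space[of B F] by (auto simp: subalgebra_def)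
    have "U -` A \<inter> space M \<in> rv_sigma M {U}"
      unfolding rv_sigma_def by (rule sigma_sets.Basic) auto
    then have "prob ((U -` A \<inter> space M) \<inter> B) = prob (U -` A \<inter> space M) * prob B"
      by (rule indep_setD[OF indep]) measurable
    moreover have "(\<lambda>\<omega>. (U \<omega>, \<omega>)) -` (A \<times> B) \<inter> space M = (U -` A \<inter> space M) \<inter> B"
      using B by auto
    moreover have "(\<lambda>x. x) -` B \<inter> space M = B" using B by auto
    ultimately show "emeasure ?D A * emeasure (distr M F (\<lambda>x. x)) B
        = emeasure (distr M (borel \<Otimes>\<^sub>M F) (\<lambda>\<omega>. (U \<omega>, \<omega>))) (A \<times> B)"
      by (simp add: emeasure_distr emeasure_eq_measure ennreal_mult)
  qed
  show thesis
  proof (rule that)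
    show "indicator A \<in> pure_tests M" by (rule indicator_pure_test[OF A])
    fix Z assume Z[measurable]: "Z \<in> borel_measurable F" and Z0: "Z \<in> L0_plus M"
    have [measurable]: "Z \<in> borel_measurable M" by (rule measurable_from_subalg[OF F Z])
    have "expect M (\<lambda>\<omega>. Z \<omega> * indicator A \<omega>) =
        (\<integral>\<^sup>+\<omega>. (\<lambda>(u, \<omega>). ennreal (Z \<omega>) * indicator {u. cdf ?D u \<le> w \<omega>} u) (U \<omega>, \<omega>) \<partial>M)"
      unfolding expect_def by (rule nn_integral_cong) (auto simp: A_def indicator_def)
    also have "\<dots> = (\<integral>\<^sup>+p. (\<lambda>(u, \<omega>). ennreal (Z \<omega>) * indicator {u. cdf ?D u \<le> w \<omega>} u) p
        \<partial>distr M (borel \<Otimes>\<^sub>M F) (\<lambda>\<omega>. (U \<omega>, \<omega>)))"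
      by (subst nn_integral_distr) (auto simp: indicator_def)
    \<comment> \<open>Fubini: for fixed \<open>\<omega>\<close>, integration over \<open>u\<close>
      replaces the event by its probability \<open>w \<omega>\<close>.\<close>
    also have "\<dots> = (\<integral>\<^sup>+\<omega>. \<integral>\<^sup>+u. ennreal (Z \<omega>) * indicator {u. cdf ?D u \<le> w \<omega>} u \<partial>?D
        \<partial>distr M F (\<lambda>x. x))"
      unfolding prod[symmetric] by (subst DP.nn_integral_snd[symmetric]) (auto simp: indicator_def)
    also have "\<dots> = (\<integral>\<^sup>+\<omega>. ennreal (Z \<omega>) * ennreal (w \<omega>) \<partial>distr M F (\<lambda>x. x))"
    proof (rule nn_integral_cong)
      fix \<omega>
      have "(\<integral>\<^sup>+u. ennreal (Z \<omega>) * indicator {u. cdf ?D u \<le> w \<omega>} u \<partial>?D)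
          = ennreal (Z \<omega>) * emeasure ?D {u. cdf ?D u \<le> w \<omega>}"
        by (rule nn_integral_cmult_indicator) measurable
      also have "emeasure ?D {u. cdf ?D u \<le> w \<omega>} = ennreal (w \<omega>)"
        using D.measure_cdf_le[OF _ w01] U(2)
        by (simp add: D.emeasure_eq_measure continuous_cdf_def)
      finally show "(\<integral>\<^sup>+u. ennreal (Z \<omega>) * indicator {u. cdf ?D u \<le> w \<omega>} u \<partial>?D)
          = ennreal (Z \<omega>) * ennreal (w \<omega>)" .
    qed
    also have "\<dots> = (\<integral>\<^sup>+\<omega>. ennreal (Z \<omega>) * ennreal (w \<omega>) \<partial>M)"
      by (subst nn_integral_distr) auto
    also have "\<dots> = (\<integral>\<^sup>+\<omega>. ennreal (Z \<omega>) * W \<omega> \<partial>M)"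
      using wW by (intro nn_integral_cong_AE) auto
    also have "\<dots> = (\<integral>\<^sup>+\<omega>. ennreal (Z \<omega>) * ennreal (X \<omega>) \<partial>M)"
      unfolding W_def by (rule F.nn_cond_exp_intg) auto
    also have "\<dots> = expect M (\<lambda>\<omega>. Z \<omega> * X \<omega>)"
      unfolding expect_def using randomized_testsD(2)[OF X] L0_plusD(2)[OF Z0]
      by (intro nn_integral_cong) (simp add: ennreal_mult)
    finally show "expect M (\<lambda>\<omega>. Z \<omega> * indicator A \<omega>) = expect M (\<lambda>\<omega>. Z \<omega> * X \<omega>)" .
  qed
qed

section \<open>Existence of an optimal randomized test\<close>

text \<open>A minimising sequence for the second moment is Cauchy in \<open>L\<^sup>2\<close> by the parallelogram law;
  this replaces weak compactness.\<close>

lemma convex_tests_AE_limit: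
  fixes C :: "nat \<Rightarrow> ('a \<Rightarrow> real) set"
  assumes dec: "decseq C" and ne: "\<And>n. C n \<noteq> {}" and sub: "\<And>n. C n \<subseteq> randomized_tests M"
    and conv: "\<And>n. rv_convex (C n)"
  obtains Xs X where "\<And>n. Xs n \<in> C n" "X \<in> randomized_tests M"
    "AE \<omega> in M. (\<lambda>n. Xs n \<omega>) \<longlonglongrightarrow> X \<omega>"
proof -
  define q where "q X = (\<integral>\<omega>. (X \<omega>)\<^sup>2 \<partial>M)" for X :: "'a \<Rightarrow> real"
  \<comment> \<open>The sets shrink, so these infima of the second moment increase; being at most 1,
    they have a limit \<open>L\<close>.\<close>
  define \<alpha> where "\<alpha> n = (INF X\<in>C n. q X)" for n
  have bdd: "bdd_below (q ` C n)" for n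
    by (rule bdd_belowI[of _ 0]) (auto simp: q_def)
  have int: "integrable M f" if [measurable]: "f \<in> borel_measurable M"
    and "\<And>\<omega>. \<omega> \<in> space M \<Longrightarrow> \<bar>f \<omega>\<bar> \<le> 1" for f :: "'a \<Rightarrow> real"
    using that by (intro integrable_const_bound[of _ 1]) auto
  have sq_int: "integrable M (\<lambda>\<omega>. (X \<omega>)\<^sup>2)" if "X \<in> randomized_tests M" for X
    using randomized_testsD[OF that] by (intro int) (auto simp: power_le_one)
  have q_le_1: "q X \<le> 1" if "X \<in> randomized_tests M" for X
  proof -
    have "q X \<le> (\<integral>\<omega>. 1 \<partial>M)"
      unfolding q_def using sq_int[OF that] randomized_testsD[OF that]
      by (intro integral_mono) (auto simp: power_le_one)
    then show ?thesis by (simp add: prob_space)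
  qed
  have "incseq \<alpha>"
    unfolding incseq_def \<alpha>_def using dec ne bdd
    by (auto intro!: cINF_superset_mono simp: decseq_def)
  moreover have \<alpha>_le_1: "\<alpha> n \<le> 1" for n
  proof -
    obtain X where "X \<in> C n" using ne by blast
    then show ?thesis
      using cINF_lower[OF bdd, of X n] q_le_1[of X] sub unfolding \<alpha>_def by fastforce
  qed
  ultimately obtain L where L: "\<alpha> \<longlonglongrightarrow> L" "\<And>n. \<alpha> n \<le> L"
    using incseq_convergent[of \<alpha> 1] by auto
  define \<epsilon> where "\<epsilon> n = inverse (real (Suc n))" for n
  have \<epsilon>: "0 < \<epsilon> n" for n by (simp add: \<epsilon>_def)
  have "\<exists>X. X \<in> C n \<and> q X < \<alpha> n + \<epsilon> n" for n
    using cINF_less_iff[OF ne bdd, of n "\<alpha> n + \<epsilon> n"] \<epsilon>[of n] unfolding \<alpha>_def by auto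
  then obtain Y where Y: "\<And>n. Y n \<in> C n" "\<And>n. q (Y n) < \<alpha> n + \<epsilon> n"
    by metis
  have YT: "Y n \<in> randomized_tests M" for n using Y sub by blast
  note [measurable] = randomized_testsD(1)[OF YT]
  have diff_le_1: "\<bar>Y i \<omega> - Y j \<omega>\<bar> \<le> 1" if "\<omega> \<in> space M" for i j \<omega>
    using randomized_testsD(2,3)[OF YT that, of i] randomized_testsD(2,3)[OF YT that, of j] by linarith
  have diff_int: "integrable M (\<lambda>\<omega>. (Y i \<omega> - Y j \<omega>)\<^sup>2)" for i j
    using diff_le_1 by (intro int) (auto simp: abs_square_le_1)
  have abs_int: "integrable M (\<lambda>\<omega>. \<bar>Y i \<omega> - Y j \<omega>\<bar>)" for i j
    using diff_le_1 by (intro int) auto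
  \<comment> \<open>\<open>b\<close> bounds the defect in the parallelogram law: for
    \<open>i \<le> j\<close> the midpoint lies in \<open>C i\<close>, so its second moment is at
    least \<open>\<alpha> i\<close>, while that of \<open>Y j\<close> is below
    \<open>\<alpha> j + \<epsilon> j\<close>, hence below \<open>L + \<epsilon> j\<close>.\<close>
  define b where "b n = L - \<alpha> n + \<epsilon> n" for n
  have "b \<longlonglongrightarrow> (L - L) + 0"
    unfolding b_def \<epsilon>_def by (intro tendsto_add tendsto_diff tendsto_const L(1) LIMSEQ_inverse_real_of_nat)
  then have b0: "b \<longlonglongrightarrow> 0" by simp
  have dist_le: "(\<integral>\<omega>. (Y i \<omega> - Y j \<omega>)\<^sup>2 \<partial>M) \<le> 2 * b i + 2 * b j" if "i \<le> j" for i j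
  proof -
    \<comment> \<open>The midpoint, with the coefficient \<open>1 - 1 / 2\<close> written so as to
      match the form in \<open>rv_convex\<close>.\<close>
    define Z where "Z \<omega> = (1 - 1 / 2) * Y i \<omega> + 1 / 2 * Y j \<omega>" for \<omega>
    have "Y j \<in> C i" using Y(1) dec that by (auto simp: decseq_def)
    then have "Z \<in> C i"
      using conv[of i] Y(1)[of i] unfolding rv_convex_def Z_def by fastforce
    then have "\<alpha> i \<le> q Z" and ZT: "Z \<in> randomized_tests M"
      using cINF_lower[OF bdd, of Z i] sub unfolding \<alpha>_def by auto
    moreover have "(\<integral>\<omega>. (Y i \<omega> - Y j \<omega>)\<^sup>2 \<partial>M) = 2 * q (Y i) + 2 * q (Y j) - 4 * q Z"
    proof -
      have "(\<integral>\<omega>. (Y i \<omega> - Y j \<omega>)\<^sup>2 \<partial>M) =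
          (\<integral>\<omega>. 2 * (Y i \<omega>)\<^sup>2 + 2 * (Y j \<omega>)\<^sup>2 - 4 * (Z \<omega>)\<^sup>2 \<partial>M)"
        by (rule Bochner_Integration.integral_cong) (auto simp: Z_def power2_eq_square field_simps)
      then show ?thesis
        using sq_int[OF YT] sq_int[OF ZT] by (simp add: q_def)
    qed
    \<comment> \<open>Stated for arbitrary \<open>d\<close> and \<open>z\<close>, so that the
      integrals become atoms of a linear problem.\<close>
    moreover have "d \<le> 2 * b i + 2 * b j"
      if "d = 2 * q (Y i) + 2 * q (Y j) - 4 * z" "\<alpha> i \<le> z" for d z
      unfolding b_def using that Y(2)[of i] Y(2)[of j] L(2)[of j] by argo
    ultimately show ?thesis by blast
  qed
  have dist_le': "(\<integral>\<omega>. (Y i \<omega> - Y j \<omega>)\<^sup>2 \<partial>M) \<le> 2 * b i + 2 * b j" for i j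
    using dist_le[of i j] dist_le[of j i] by (cases "i \<le> j") (auto simp: power2_commute add.commute)
  have cauchy: "\<exists>N. \<forall>i\<ge>N. \<forall>j\<ge>N. (\<integral>\<omega>. norm (Y i \<omega> - Y j \<omega>) \<partial>M) < e" if e: "e > 0" for e
  proof -
    have "eventually (\<lambda>n. b n < e\<^sup>2 / 4) sequentially"
      using order_tendstoD(2)[OF b0, of "e\<^sup>2 / 4"] e by simp
    then obtain N where N: "\<And>n. n \<ge> N \<Longrightarrow> b n < e\<^sup>2 / 4" by (auto simp: eventually_sequentially)
    have "(\<integral>\<omega>. norm (Y i \<omega> - Y j \<omega>) \<partial>M) < e" if "i \<ge> N" "j \<ge> N" for i j
    proof -
      \<comment> \<open>From the second moment to the first: an elementary inequality, with its
        weight tuned to \<open>e\<close>, takes the place of Cauchy-Schwarz. With \<open>b\<close>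
        below \<open>e\<^sup>2 / 4\<close> the quadratic term contributes less than
        \<open>e / 2\<close>.\<close>
      have pt: "\<bar>d\<bar> \<le> e / 2 + d\<^sup>2 / (2 * e)" for d :: real
      proof -
        have "0 \<le> (\<bar>d\<bar> - e)\<^sup>2" by simp
        then have "2 * e * \<bar>d\<bar> \<le> e\<^sup>2 + d\<^sup>2" by (simp add: power2_diff algebra_simps)
        then show ?thesis using e by (simp add: field_simps power2_eq_square)
      qed
      have "(\<integral>\<omega>. norm (Y i \<omega> - Y j \<omega>) \<partial>M) \<le> (\<integral>\<omega>. e / 2 + (Y i \<omega> - Y j \<omega>)\<^sup>2 / (2 * e) \<partial>M)"
        using diff_int abs_int pt by (intro integral_mono) auto
      also have "\<dots> = e / 2 + (\<integral>\<omega>. (Y i \<omega> - Y j \<omega>)\<^sup>2 \<partial>M) / (2 * e)"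
        using diff_int by (simp add: prob_space)
      also have "\<dots> < e / 2 + e\<^sup>2 / (2 * e)"
        using dist_le'[of i j] N[of i] N[of j] that e
        by (intro add_strict_left_mono divide_strict_right_mono) auto
      also have "\<dots> = e" using e by (simp add: power2_eq_square)
      finally show ?thesis .
    qed
    then show ?thesis by blast
  qed
  have "integrable M (Y n)" for n
    using randomized_testsD[OF YT] by (intro int) auto
  then obtain r :: "nat \<Rightarrow> nat" where r: "strict_mono r" "AE \<omega> in M. Cauchy (\<lambda>i. Y (r i) \<omega>)"
    using cauchy_L1_AE_cauchy_subseq[where s=Y] cauchy by blast
  \<comment> \<open>Truncation keeps the values in [0,1] also where the sequence diverges and
    \<open>lim\<close> is unspecified.\<close>
  define X where "X \<omega> = max 0 (min 1 (lim (\<lambda>i. Y (r i) \<omega>)))" for \<omega>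
  show thesis
  proof (rule that)
    \<comment> \<open>A strictly increasing index satisfies \<open>n \<le> r n\<close>, and the sets
      decrease.\<close>
    show "Y (r n) \<in> C n" for n
      using Y(1)[of "r n"] dec seq_suble[OF r(1), of n] by (auto simp: decseq_def)
    have "X \<in> borel_measurable M" unfolding X_def by measurable
    then show "X \<in> randomized_tests M" by (auto simp: randomized_tests_def X_def)
    show "AE \<omega> in M. (\<lambda>n. Y (r n) \<omega>) \<longlonglongrightarrow> X \<omega>"
      using r(2) AE_space
    proof eventually_elim
      case (elim \<omega>)
      then have lim: "(\<lambda>n. Y (r n) \<omega>) \<longlonglongrightarrow> lim (\<lambda>n. Y (r n) \<omega>)"
        by (simp add: Cauchy_convergent_iff convergent_LIMSEQ_iff)
      then have "0 \<le> lim (\<lambda>n. Y (r n) \<omega>)" "lim (\<lambda>n. Y (r n) \<omega>) \<le> 1"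
        using randomized_testsD(2,3)[OF YT elim(2)]
        by (auto intro: LIMSEQ_le_const LIMSEQ_le_const2)
      then show ?case using lim by (simp add: X_def)
    qed
  qed
qed

text \<open>Near-optimal feasible tests form decreasing convex sets, so
  \<open>convex_tests_AE_limit\<close> supplies a limit of tests whose worst powers approach the
  supremum. Dominated convergence passes both the size bounds and the power bounds to the
  limit.\<close>

lemma ex_solves_V:
  assumes \<G>: "\<G> \<subseteq> L0_plus M" "\<And>G. G \<in> \<G> \<Longrightarrow> expect M G < \<top>"
    and \<H>: "\<H> \<subseteq> L0_plus M" "\<And>H. H \<in> \<H> \<Longrightarrow> expect M H < \<top>"
    and x: "0 \<le> x"
  obtains X where "solves_V M \<G> \<H> x X"
proof -
  let ?F = "feasible M (randomized_tests M) \<H> x"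
  have "(\<lambda>_. 0) \<in> ?F"
    by (auto simp: feasible_def randomized_tests_def expect_def)
  then have "worst_power M \<G> ` ?F \<noteq> {}" by blast
  from ennreal_Sup_countable_SUP[OF this] obtain f :: "nat \<Rightarrow> ennreal" where
    f: "incseq f" "range f \<subseteq> worst_power M \<G> ` ?F" "V M \<G> \<H> x = (SUP i. f i)"
    unfolding V_def by blast
  \<comment> \<open>A superlevel set of a concave function, hence convex; it is nonempty because
    \<open>f n\<close> is itself the worst power of a feasible test.\<close>
  define C where "C n = {X \<in> ?F. f n \<le> worst_power M \<G> X}" for n
  have CT: "C n \<subseteq> randomized_tests M" for n by (auto simp: C_def feasible_def)
  have conv: "rv_convex (C n)" for n
    unfolding rv_convex_def
  proof (intro ballI)
    fix Y Z and t :: real assume Y: "Y \<in> C n" and Z: "Z \<in> C n" and "t \<in> {0..1}"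
    then have t: "0 \<le> t" "t \<le> 1" by auto
    have "f n = ennreal (1 - t) * f n + ennreal t * f n"
      using t by (simp add: distrib_right[symmetric] ennreal_plus[symmetric] del: ennreal_plus)
    also have "\<dots> \<le> ennreal (1 - t) * worst_power M \<G> Y + ennreal t * worst_power M \<G> Z"
      using Y Z by (intro add_mono mult_left_mono) (auto simp: C_def)
    also have "\<dots> \<le> worst_power M \<G> (\<lambda>\<omega>. (1 - t) * Y \<omega> + t * Z \<omega>)"
      using Y Z CT by (intro worst_power_concave[OF \<G>(1) t]) auto
    finally have "f n \<le> worst_power M \<G> (\<lambda>\<omega>. (1 - t) * Y \<omega> + t * Z \<omega>)" .
    moreover have "(1 - t) * x + t * x = x" by (simp add: algebra_simps)
    ultimately show "(\<lambda>\<omega>. (1 - t) * Y \<omega> + t * Z \<omega>) \<in> C n"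
      using feasible_convex_comb[OF \<H>(1) t x x, of Y Z] Y Z by (simp add: C_def)
  qed
  have ne: "C n \<noteq> {}" for n
  proof -
    have "f n \<in> worst_power M \<G> ` ?F" using f(2) by blast
    then show ?thesis by (auto simp: C_def)
  qed
  have "decseq C"
    using f(1) by (auto simp: decseq_def C_def incseq_def intro: order.trans)
  from convex_tests_AE_limit[OF this ne CT conv] obtain Xs X where
    Xs: "\<And>n. Xs n \<in> C n" and X: "X \<in> randomized_tests M"
    and lim: "AE \<omega> in M. (\<lambda>n. Xs n \<omega>) \<longlonglongrightarrow> X \<omega>" by blast
  have XsT: "Xs n \<in> randomized_tests M" for n using Xs CT by blast
  note tendsto = expect_tendsto_tests[OF _ _ XsT X lim]
  have feas: "X \<in> ?F"
    unfolding feasible_def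
  proof (intro CollectI conjI ballI X)
    fix H assume H: "H \<in> \<H>"
    have "expect M (\<lambda>\<omega>. H \<omega> * Xs n \<omega>) \<le> ennreal x" for n
      using Xs[of n] H by (auto simp: C_def feasible_def)
    then show "expect M (\<lambda>\<omega>. H \<omega> * X \<omega>) \<le> ennreal x"
      using H \<H> by (intro LIMSEQ_le_const2[OF tendsto[of H]]) auto
  qed
  have "V M \<G> \<H> x \<le> worst_power M \<G> X"
    unfolding worst_power_def
  proof (rule INF_greatest)
    fix G assume G: "G \<in> \<G>"
    have "f n \<le> expect M (\<lambda>\<omega>. G \<omega> * Xs n \<omega>)" for n
      using Xs[of n] G by (auto simp: C_def worst_power_def intro: order.trans INF_lower)
    then show "V M \<G> \<H> x \<le> expect M (\<lambda>\<omega>. G \<omega> * X \<omega>)"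
      unfolding f(3) using G \<G> LIMSEQ_SUP[OF f(1)]
      by (intro LIMSEQ_le[OF _ tendsto[of G]]) auto
  qed
  moreover have "worst_power M \<G> X \<le> V M \<G> \<H> x"
    unfolding V_def by (rule SUP_upper[OF feas])
  ultimately show thesis
    using that feas by (auto simp: solves_V_def)
qed

section \<open>The Neyman-Pearson lemma with a pure test\<close>

text \<open>Unless threshold 0 is already admissible, \<open>a\<close> is the least nonnegative
  threshold for which rejecting where \<open>a * H < G\<close> keeps the size at most
  \<open>x\<close>. Right continuity of the size makes \<open>a\<close> admissible, the left limit
  shows that adding all ties brings the size to at least \<open>x\<close>, and
  \<open>nonatomic_subset_expect\<close> selects a part of the ties that gives exactly
  \<open>x\<close>.\<close>

lemma neyman_pearson_pure:
  assumes G: "G \<in> L0_plus M" and H: "H \<in> L0_plus M" "expect M H < \<top>"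
    and U: "U \<in> borel_measurable M" "continuous_cdf M U" and x: "0 < x"
  obtains X' where "X' \<in> pure_tests M" "expect M (\<lambda>\<omega>. H \<omega> * X' \<omega>) \<le> ennreal x"
    "\<And>X. X \<in> randomized_tests M \<Longrightarrow> expect M (\<lambda>\<omega>. H \<omega> * X \<omega>) \<le> ennreal x \<Longrightarrow>
       expect M (\<lambda>\<omega>. G \<omega> * X \<omega>) \<le> expect M (\<lambda>\<omega>. G \<omega> * X' \<omega>)"
proof -
  note [measurable] = L0_plusD(1)[OF G] L0_plusD(1)[OF H(1)] U(1)
  note nn = L0_plusD(2)[OF G] L0_plusD(2)[OF H(1)]
  define Q where "Q a = {\<omega>\<in>space M. a * H \<omega> < G \<omega>}" for a
  \<comment> \<open>Where \<open>H\<close> vanishes, \<open>Q a\<close> keeps the points with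
    \<open>0 < G\<close> for every \<open>a\<close>. Requiring \<open>0 < H\<close> makes the sets
    shrink to the empty set as \<open>a\<close> grows, and integrals against \<open>H\<close> do not
    see the difference.\<close>
  define P where "P a = {\<omega>\<in>space M. 0 < H \<omega> \<and> a * H \<omega> < G \<omega>}" for a
  define \<phi> where "\<phi> a = expect M (\<lambda>\<omega>. H \<omega> * indicator (P a) \<omega>)" for a
  have Qm[measurable]: "Q a \<in> sets M" for a unfolding Q_def by measurable
  have Pm[measurable]: "P a \<in> sets M" for a unfolding P_def by measurable
  have ind: "indicator A \<in> randomized_tests M" if "A \<in> sets M" for A
    using indicator_pure_test[OF that] pure_tests_subset by blast
  note tendsto = expect_tendsto_tests[OF H ind ind]
  have \<phi>_Q: "expect M (\<lambda>\<omega>. H \<omega> * indicator (Q a) \<omega>) = \<phi> a" for a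
    unfolding \<phi>_def expect_def using nn
    by (intro nn_integral_cong) (force simp: indicator_def P_def Q_def)
  have \<phi>_antimono: "\<phi> a' \<le> \<phi> a" if "a \<le> a'" for a a'
    unfolding \<phi>_def expect_def
  proof (intro nn_integral_mono ennreal_leI)
    fix \<omega> assume \<omega>: "\<omega> \<in> space M"
    have "a * H \<omega> \<le> a' * H \<omega>" using that nn(2)[OF \<omega>] by (rule mult_right_mono)
    then show "H \<omega> * indicator (P a') \<omega> \<le> H \<omega> * indicator (P a) \<omega>"
      using nn(2)[OF \<omega>] by (auto simp: indicator_def P_def)
  qed
  show thesis
  proof (cases "\<phi> 0 \<le> ennreal x")
    \<comment> \<open>Rejecting where \<open>0 < G\<close> is affordable and captures the whole of
      \<open>expect M G\<close>, the largest power any test can have.\<close>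
    case True
    show ?thesis
    proof (rule that)
      show "indicator (Q 0) \<in> pure_tests M" by (rule indicator_pure_test) measurable
      show "expect M (\<lambda>\<omega>. H \<omega> * indicator (Q 0) \<omega>) \<le> ennreal x" using True by (simp add: \<phi>_Q)
      fix X assume X: "X \<in> randomized_tests M"
      have "expect M G = expect M (\<lambda>\<omega>. G \<omega> * indicator (Q 0) \<omega>)"
        unfolding expect_def using nn by (intro nn_integral_cong) (force simp: indicator_def Q_def)
      then show "expect M (\<lambda>\<omega>. G \<omega> * X \<omega>) \<le> expect M (\<lambda>\<omega>. G \<omega> * indicator (Q 0) \<omega>)"
        using expect_times_test_le[OF G X] by simp
    qed
  next
    case False
    define T where "T = {a. 0 \<le> a \<and> \<phi> a \<le> ennreal x}"
    have bdd: "bdd_below T" by (rule bdd_belowI[of _ 0]) (auto simp: T_def)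
    \<comment> \<open>Some integer threshold is admissible, so \<open>T\<close> is nonempty and its
      infimum meaningful.\<close>
    have "(\<lambda>n. \<phi> (real n)) \<longlonglongrightarrow> expect M (\<lambda>\<omega>. H \<omega> * indicator {} \<omega>)"
      unfolding \<phi>_def
    proof (rule tendsto)
      show "AE \<omega> in M. (\<lambda>n. indicator (P (real n)) \<omega> :: real) \<longlonglongrightarrow> indicator {} \<omega>"
      proof (rule AE_I2)
        fix \<omega> assume \<omega>: "\<omega> \<in> space M"
        have "eventually (\<lambda>n. indicator (P (real n)) \<omega> = (indicator {} \<omega> :: real)) sequentially"
        proof (cases "0 < H \<omega>")
          case True
          obtain n0 where n0: "G \<omega> / H \<omega> < real n0" using reals_Archimedean2 by blast
          have "indicator (P (real n)) \<omega> = (indicator {} \<omega> :: real)" if "n \<ge> n0" for n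
          proof -
            have "G \<omega> / H \<omega> < real n" using n0 that by linarith
            then show ?thesis using True by (auto simp: P_def divide_less_eq)
          qed
          then show ?thesis by (auto simp: eventually_sequentially)
        qed (auto simp: P_def)
        then show "(\<lambda>n. indicator (P (real n)) \<omega> :: real) \<longlonglongrightarrow> indicator {} \<omega>"
          by (rule tendsto_eventually)
      qed
    qed measurable
    then have "(\<lambda>n. \<phi> (real n)) \<longlonglongrightarrow> 0" by (simp add: expect_def)
    then have "eventually (\<lambda>n. \<phi> (real n) < ennreal x) sequentially"
      using x by (intro order_tendstoD(2)) auto
    then obtain n where "\<phi> (real n) < ennreal x" by (auto simp: eventually_sequentially)
    then have T: "real n \<in> T" by (auto simp: T_def)
    then have ne: "T \<noteq> {}" by blast
    define a where "a = Inf T"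
    have "0 \<le> a" unfolding a_def by (rule cInf_greatest[OF ne]) (auto simp: T_def)
    \<comment> \<open>Right continuity: the strict inequality defining \<open>P a\<close> survives a
      small increase of the threshold, and every threshold above the infimum is admissible.\<close>
    have \<phi>_a: "\<phi> a \<le> ennreal x"
    proof (rule LIMSEQ_le_const2)
      show "(\<lambda>n. \<phi> (a + inverse (real (Suc n)))) \<longlonglongrightarrow> \<phi> a"
        unfolding \<phi>_def
      proof (rule tendsto)
        show "AE \<omega> in M. (\<lambda>n. indicator (P (a + inverse (real (Suc n)))) \<omega> :: real) \<longlonglongrightarrow> indicator (P a) \<omega>"
        proof (rule AE_I2, rule tendsto_eventually)
          fix \<omega> assume \<omega>: "\<omega> \<in> space M"
          have lim: "(\<lambda>n. (a + inverse (real (Suc n))) * H \<omega>) \<longlonglongrightarrow> a * H \<omega>"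
            by (intro tendsto_mult LIMSEQ_inverse_real_of_nat_add tendsto_const)
          have ge: "a * H \<omega> \<le> (a + inverse (real (Suc n))) * H \<omega>" for n
            using nn(2)[OF \<omega>] by (intro mult_right_mono) auto
          show "eventually (\<lambda>n. indicator (P (a + inverse (real (Suc n)))) \<omega> = (indicator (P a) \<omega> :: real)) sequentially"
          proof (cases "a * H \<omega> < G \<omega>")
            case True
            from order_tendstoD(2)[OF lim this] show ?thesis
              by eventually_elim (use True in \<open>auto simp: P_def indicator_def\<close>)
          next
            case False
            then have "\<not> (a + inverse (real (Suc n))) * H \<omega> < G \<omega>" for n using ge[of n] by linarith
            then show ?thesis using False by (auto simp: P_def indicator_def)
          qed
        qed
      qed measurable
      have "\<phi> (a + inverse (real (Suc n))) \<le> ennreal x" for n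
      proof -
        obtain t where "t \<in> T" "t < a + inverse (real (Suc n))"
          using cInf_less_iff[OF ne bdd, of "a + inverse (real (Suc n))"] by (auto simp: a_def)
        then show ?thesis using \<phi>_antimono[of t "a + inverse (real (Suc n))"] by (auto simp: T_def)
      qed
      then show "\<exists>N. \<forall>n\<ge>N. \<phi> (a + inverse (real (Suc n))) \<le> ennreal x" by blast
    qed
    \<comment> \<open>Positivity leaves room to approach \<open>a\<close> from the left by
      nonnegative thresholds, which lie outside \<open>T\<close> and so have size above
      \<open>x\<close>.\<close>
    have "0 < a" using \<open>0 \<le> a\<close> \<phi>_a False by (cases "a = 0") auto
    define R where "R = {\<omega>\<in>space M. 0 < H \<omega> \<and> a * H \<omega> \<le> G \<omega>}"
    have Rm[measurable]: "R \<in> sets M" unfolding R_def by measurable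
    \<comment> \<open>In the limit from the left the strict inequality becomes weak, so
      \<open>R\<close> includes the ties with \<open>0 < H\<close>.\<close>
    have x_le: "ennreal x \<le> expect M (\<lambda>\<omega>. H \<omega> * indicator R \<omega>)"
    proof (rule LIMSEQ_le_const)
      show "(\<lambda>n. \<phi> (a + - inverse (real (Suc n)))) \<longlonglongrightarrow> expect M (\<lambda>\<omega>. H \<omega> * indicator R \<omega>)"
        unfolding \<phi>_def
      proof (rule tendsto)
        show "AE \<omega> in M. (\<lambda>n. indicator (P (a + - inverse (real (Suc n)))) \<omega> :: real) \<longlonglongrightarrow> indicator R \<omega>"
        proof (rule AE_I2, rule tendsto_eventually)
          fix \<omega> assume \<omega>: "\<omega> \<in> space M"
          have lim: "(\<lambda>n. (a + - inverse (real (Suc n))) * H \<omega>) \<longlonglongrightarrow> a * H \<omega>"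
            by (intro tendsto_mult LIMSEQ_inverse_real_of_nat_add_minus tendsto_const)
          show "eventually (\<lambda>n. indicator (P (a + - inverse (real (Suc n)))) \<omega> = (indicator R \<omega> :: real)) sequentially"
          proof (cases "G \<omega> < a * H \<omega>")
            case True
            from order_tendstoD(1)[OF lim this] show ?thesis
              by eventually_elim (use True in \<open>auto simp: P_def R_def indicator_def\<close>)
          next
            case False
            have "(a + - inverse (real (Suc n))) * H \<omega> < G \<omega>" if "0 < H \<omega>" for n
            proof -
              have "(a + - inverse (real (Suc n))) * H \<omega> < a * H \<omega>"
                using that by (intro mult_strict_right_mono) auto
              then show ?thesis using False by linarith
            qed
            then show ?thesis using False by (auto simp: P_def R_def indicator_def)
          qed
        qed
      qed measurable
      obtain N where N: "inverse (real (Suc N)) < a"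
        using reals_Archimedean[OF \<open>0 < a\<close>] by blast
      have "ennreal x \<le> \<phi> (a + - inverse (real (Suc n)))" if "n \<ge> N" for n
      proof -
        have "inverse (real (Suc n)) \<le> inverse (real (Suc N))"
          using that by (intro le_imp_inverse_le) auto
        then have "0 \<le> a + - inverse (real (Suc n))" using N by linarith
        moreover have "a + - inverse (real (Suc n)) \<notin> T"
          using cInf_lower[OF _ bdd, of "a + - inverse (real (Suc n))"] unfolding a_def[symmetric]
          by (auto simp: not_le)
        ultimately show ?thesis by (auto simp: T_def)
      qed
      then show "\<exists>N. \<forall>n\<ge>N. ennreal x \<le> \<phi> (a + - inverse (real (Suc n)))" by blast
    qed
    define E where "E = {\<omega>\<in>space M. G \<omega> = a * H \<omega>}"
    have Em[measurable]: "E \<in> sets M" unfolding E_def by measurable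
    \<comment> \<open>The ties carry the size that is still missing; \<open>f\<close> is the density
      to be split.\<close>
    define f where "f = (\<lambda>\<omega>. H \<omega> * indicator E \<omega>)"
    have f: "f \<in> L0_plus M" using nn by (auto simp: L0_plus_def f_def)
    have add: "expect M (\<lambda>\<omega>. H \<omega> * indicator (Q a \<union> E \<inter> S) \<omega>) = \<phi> a + expect M (\<lambda>\<omega>. f \<omega> * indicator S \<omega>)"
      if [measurable]: "S \<in> sets M" for S
    proof -
      have "expect M (\<lambda>\<omega>. H \<omega> * indicator (Q a \<union> E \<inter> S) \<omega>) =
          (\<integral>\<^sup>+\<omega>. ennreal (H \<omega> * indicator (Q a) \<omega>) + ennreal (f \<omega> * indicator S \<omega>) \<partial>M)"
        unfolding expect_def by (rule nn_integral_cong) (auto simp: indicator_def f_def Q_def E_def)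
      also have "\<dots> = \<phi> a + expect M (\<lambda>\<omega>. f \<omega> * indicator S \<omega>)"
        unfolding \<phi>_Q[symmetric] expect_def f_def by (rule nn_integral_add) measurable
      finally show ?thesis .
    qed
    have ef: "expect M (\<lambda>\<omega>. f \<omega> * indicator (space M) \<omega>) = expect M f"
      by (auto simp: expect_def intro!: nn_integral_cong)
    have "expect M (\<lambda>\<omega>. H \<omega> * indicator R \<omega>) \<le> expect M (\<lambda>\<omega>. H \<omega> * indicator (Q a \<union> E \<inter> space M) \<omega>)"
      unfolding expect_def using nn(2)
      by (intro nn_integral_mono ennreal_leI) (auto simp: indicator_def R_def Q_def E_def)
    then have x_le': "ennreal x \<le> \<phi> a + expect M f"
      using x_le add[OF sets.top] ef by simp
    obtain p where p: "\<phi> a = ennreal p" "0 \<le> p" "p \<le> x"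
      using \<phi>_a x by (cases "\<phi> a") (auto simp: top_unique)
    have "ennreal p + ennreal (x - p) \<le> ennreal p + expect M f"
      using x_le' p by (simp add: ennreal_plus[symmetric] del: ennreal_plus)
    then have "ennreal (x - p) \<le> expect M f"
      by (simp add: ennreal_add_left_cancel_le)
    moreover have "expect M f < \<top>"
      using expect_times_test_le[OF H(1) ind[OF Em]] H(2) by (simp add: f_def)
    ultimately obtain S where S[measurable]: "S \<in> sets M"
      and eS: "expect M (\<lambda>\<omega>. f \<omega> * indicator S \<omega>) = ennreal (x - p)"
      using nonatomic_subset_expect[OF f _ U, of "x - p"] p by auto
    let ?S = "Q a \<union> E \<inter> S"
    have size: "expect M (\<lambda>\<omega>. H \<omega> * indicator ?S \<omega>) = ennreal x"
      using add[OF S] eS p by (simp add: ennreal_plus[symmetric] del: ennreal_plus)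
    show ?thesis
    proof (rule that)
      show "indicator ?S \<in> pure_tests M" by (rule indicator_pure_test) measurable
      show "expect M (\<lambda>\<omega>. H \<omega> * indicator ?S \<omega>) \<le> ennreal x" by (simp add: size)
      fix X assume X: "X \<in> randomized_tests M" and Xx: "expect M (\<lambda>\<omega>. H \<omega> * X \<omega>) \<le> ennreal x"
      show "expect M (\<lambda>\<omega>. G \<omega> * X \<omega>) \<le> expect M (\<lambda>\<omega>. G \<omega> * indicator ?S \<omega>)"
      proof (rule likelihood_ratio_test_optimal[OF G H(1) \<open>0 \<le> a\<close> X])
        show "indicator ?S \<in> randomized_tests M" by (rule ind) measurable
        show "AE \<omega> in M. (a * H \<omega> < G \<omega> \<longrightarrow> indicator ?S \<omega> = (1::real)) \<and>
            (G \<omega> < a * H \<omega> \<longrightarrow> indicator ?S \<omega> = (0::real))"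
          by (rule AE_I2) (auto simp: Q_def E_def indicator_def)
      qed (use Xx size in auto)
    qed
  qed
qed

section \<open>Pure optimal tests under each of the three conditions\<close>

text \<open>All members of \<open>\<G>\<close> agree almost surely, as do those of
  \<open>\<H>\<close>, so infimum and constraints reduce to one representative each and
  \<open>neyman_pearson_pure\<close> applies.\<close>

lemma pure_optimal_C1:
  assumes \<G>: "\<G> \<subseteq> L0_plus M" and \<H>: "\<H> \<subseteq> L0_plus M" "\<And>H. H \<in> \<H> \<Longrightarrow> expect M H < \<top>"
    and C1: "condition_C1 M \<G> \<H>" and x: "0 < x"
  shows "\<exists>X'\<in>feasible M (pure_tests M) \<H> x.
      \<forall>X\<in>feasible M (randomized_tests M) \<H> x. worst_power M \<G> X \<le> worst_power M \<G> X'"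
proof -
  obtain U G H where U: "U \<in> borel_measurable M" "continuous_cdf M U"
    and G: "G \<in> \<G>" "\<And>Z. Z \<in> \<G> \<Longrightarrow> AE \<omega> in M. Z \<omega> = G \<omega>"
    and H: "H \<in> \<H>" "\<And>Z. Z \<in> \<H> \<Longrightarrow> AE \<omega> in M. Z \<omega> = H \<omega>"
    using C1 unfolding condition_C1_def rv_singleton_def by blast
  have eq: "expect M (\<lambda>\<omega>. Z \<omega> * X \<omega>) = expect M (\<lambda>\<omega>. Y \<omega> * X \<omega>)"
    if "AE \<omega> in M. Z \<omega> = Y \<omega>" for X Y Z :: "'a \<Rightarrow> real"
    unfolding expect_def using that by (intro nn_integral_cong_AE) auto
  have wp: "worst_power M \<G> X = expect M (\<lambda>\<omega>. G \<omega> * X \<omega>)" for X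
  proof -
    have "worst_power M \<G> X = (INF Z\<in>\<G>. expect M (\<lambda>\<omega>. G \<omega> * X \<omega>))"
      unfolding worst_power_def by (intro INF_cong refl eq G(2))
    then show ?thesis using G(1) by (metis INF_const empty_iff)
  qed
  obtain X' where X': "X' \<in> pure_tests M" "expect M (\<lambda>\<omega>. H \<omega> * X' \<omega>) \<le> ennreal x"
    "\<And>X. X \<in> randomized_tests M \<Longrightarrow> expect M (\<lambda>\<omega>. H \<omega> * X \<omega>) \<le> ennreal x \<Longrightarrow>
       expect M (\<lambda>\<omega>. G \<omega> * X \<omega>) \<le> expect M (\<lambda>\<omega>. G \<omega> * X' \<omega>)"
    using neyman_pearson_pure[OF _ _ \<H>(2)[OF H(1)] U x, of G] \<G> \<H> G H by blast
  then have "X' \<in> feasible M (pure_tests M) \<H> x"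
    using eq[OF H(2), of _ X'] by (simp add: feasible_def)
  then show ?thesis
    using X'(3) H(1) by (auto simp: wp feasible_def)
qed

text \<open>The derandomized test has the same expectation against every member of
  \<open>\<G> \<union> \<H>\<close>, hence the same sizes and the same worst power as an optimal
  randomized test.\<close>

lemma pure_optimal_C2:
  assumes \<G>: "\<G> \<subseteq> L0_plus M" "\<And>G. G \<in> \<G> \<Longrightarrow> expect M G < \<top>"
    and \<H>: "\<H> \<subseteq> L0_plus M" "\<And>H. H \<in> \<H> \<Longrightarrow> expect M H < \<top>"
    and C2: "condition_C2 M \<G> \<H>" and x: "0 < x"
  shows "\<exists>X'\<in>feasible M (pure_tests M) \<H> x.
      \<forall>X\<in>feasible M (randomized_tests M) \<H> x. worst_power M \<G> X \<le> worst_power M \<G> X'"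
proof -
  let ?gen = "{Z -` A \<inter> space M | Z A. Z \<in> \<G> \<union> \<H> \<and> A \<in> sets borel}"
  define F where "F = sigma (space M) ?gen"
  obtain U where U: "U \<in> borel_measurable M" "continuous_cdf M U"
    and indep: "indep_set (rv_sigma M {U}) (rv_sigma M (\<G> \<union> \<H>))"
    using C2 unfolding condition_C2_def by blast
  have sets_F: "sets F = rv_sigma M (\<G> \<union> \<H>)"
    unfolding F_def rv_sigma_def by (rule sets_measure_of) auto
  have "?gen \<subseteq> sets M"
    using \<G>(1) \<H>(1) by (auto simp: L0_plus_def)
  then have F: "subalgebra M F"
    unfolding subalgebra_def sets_F rv_sigma_def
    by (auto simp: F_def space_measure_of_conv intro!: sets.sigma_sets_subset)
  obtain X where X: "solves_V M \<G> \<H> x X"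
    using ex_solves_V[OF \<G> \<H>] x by (metis less_imp_le)
  then have XT: "X \<in> randomized_tests M" by (simp add: solves_V_def feasible_def)
  obtain X' where X': "X' \<in> pure_tests M"
    "\<And>Z. Z \<in> borel_measurable F \<Longrightarrow> Z \<in> L0_plus M \<Longrightarrow>
       expect M (\<lambda>\<omega>. Z \<omega> * X' \<omega>) = expect M (\<lambda>\<omega>. Z \<omega> * X \<omega>)"
    using derandomize_independent[OF F U indep[folded sets_F] XT] by blast
  have eq: "expect M (\<lambda>\<omega>. Z \<omega> * X' \<omega>) = expect M (\<lambda>\<omega>. Z \<omega> * X \<omega>)" if "Z \<in> \<G> \<union> \<H>" for Z
    using that \<G>(1) \<H>(1) unfolding F_def by (intro X'(2)[unfolded F_def] rv_sigma_measurable) auto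
  have "worst_power M \<G> X' = worst_power M \<G> X"
    unfolding worst_power_def using eq by (intro INF_cong) auto
  then have "\<forall>Y\<in>feasible M (randomized_tests M) \<H> x. worst_power M \<G> Y \<le> worst_power M \<G> X'"
    using X by (auto simp: solves_V_def V_def intro: SUP_upper)
  moreover have "X' \<in> feasible M (pure_tests M) \<H> x"
    using X X'(1) eq by (auto simp: solves_V_def feasible_def)
  ultimately show ?thesis by blast
qed

text \<open>The triplet provides a saddle point: \<open>X'\<close> is best against \<open>G\<close>,
  and \<open>G\<close> is least favourable for \<open>X'\<close>.\<close>

lemma pure_optimal_C3:
  assumes \<G>: "\<G> \<subseteq> L0_plus M" and \<H>: "\<H> \<subseteq> L0_plus M"
    and C3: "condition_C3 M \<G> \<H>" and x: "0 < x"
  shows "\<exists>X'\<in>feasible M (pure_tests M) \<H> x.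
      \<forall>X\<in>feasible M (randomized_tests M) \<H> x. worst_power M \<G> X \<le> worst_power M \<G> X'"
proof (cases "ennreal x < (SUP H\<in>\<H>. expect M H)")
  case False
  \<comment> \<open>No expectation over \<open>\<H>\<close> exceeds \<open>x\<close>, so even the
    constant test 1, which dominates every test, is feasible.\<close>
  have "(\<lambda>_. 1) \<in> feasible M (pure_tests M) \<H> x"
    using False by (auto simp: feasible_def pure_tests_def not_less SUP_le_iff)
  moreover have "worst_power M \<G> X \<le> worst_power M \<G> (\<lambda>_. 1)" if "X \<in> randomized_tests M" for X
    unfolding worst_power_def using \<G> that
    by (intro INF_mono) (auto intro!: bexI expect_times_test_le)
  ultimately show ?thesis by (auto simp: feasible_def intro!: bexI[of _ "\<lambda>_. 1"])
next
  case True
  then obtain G H a where "optimal_triplet M \<G> \<H> x G H a"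
    and null: "measure M {\<omega>\<in>space M. G \<omega> = a * H \<omega>} = 0"
    using C3 x unfolding condition_C3_def by blast
  then obtain X' B where G: "G \<in> \<G>" and H: "H \<in> closed_convex_hull M \<H>" and a: "0 \<le> a"
    and X': "X' \<in> feasible M (randomized_tests M) \<H> x"
    and form: "\<And>\<omega>. \<omega> \<in> space M \<Longrightarrow> X' \<omega> = of_bool (G \<omega> > a * H \<omega>) + B \<omega> * of_bool (G \<omega> = a * H \<omega>)"
    and size: "expect M (\<lambda>\<omega>. H \<omega> * X' \<omega>) = ennreal x"
    and least: "\<And>G'. G' \<in> \<G> \<Longrightarrow> expect M (\<lambda>\<omega>. G \<omega> * X' \<omega>) \<le> expect M (\<lambda>\<omega>. G' \<omega> * X' \<omega>)"
    unfolding optimal_triplet_def by blast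
  have H_le: "H \<in> L0_plus M \<and> expect M (\<lambda>\<omega>. H \<omega> * X \<omega>) \<le> ennreal x"
    if "X \<in> feasible M (randomized_tests M) \<H> x" for X
    using that by (intro expect_closed_convex_hull_le[OF \<H> _ _ H]) (auto simp: feasible_def)
  have GL: "G \<in> L0_plus M" and HL: "H \<in> L0_plus M" using G \<G> H_le[OF X'] by auto
  note [measurable] = L0_plusD(1)[OF GL] L0_plusD(1)[OF HL]
  let ?A = "{\<omega>\<in>space M. a * H \<omega> < G \<omega>}"
  have XT: "X' \<in> randomized_tests M" using X' by (simp add: feasible_def)
  have "AE \<omega> in M. G \<omega> \<noteq> a * H \<omega>"
    by (rule AE_I[of _ _ "{\<omega>\<in>space M. G \<omega> = a * H \<omega>}"]) (auto simp: emeasure_eq_measure null)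
  then have AE: "AE \<omega> in M. X' \<omega> = indicator ?A \<omega>"
    using AE_space by eventually_elim (auto simp: form)
  have eq: "expect M (\<lambda>\<omega>. Z \<omega> * indicator ?A \<omega>) = expect M (\<lambda>\<omega>. Z \<omega> * X' \<omega>)" for Z
    unfolding expect_def using AE by (intro nn_integral_cong_AE) auto
  have "indicator ?A \<in> pure_tests M" by (rule indicator_pure_test) measurable
  then have feas: "indicator ?A \<in> feasible M (pure_tests M) \<H> x"
    using X' by (simp add: feasible_def eq)
  have "worst_power M \<G> X \<le> worst_power M \<G> (indicator ?A)"
    if X: "X \<in> feasible M (randomized_tests M) \<H> x" for X
  proof -
    have "worst_power M \<G> X \<le> expect M (\<lambda>\<omega>. G \<omega> * X \<omega>)"
      unfolding worst_power_def by (rule INF_lower[OF G])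
    \<comment> \<open>Feasibility of \<open>X\<close> bounds its size under \<open>H\<close> by
      \<open>x\<close>, which is exactly the size of \<open>X'\<close>.\<close>
    also have "\<dots> \<le> expect M (\<lambda>\<omega>. G \<omega> * X' \<omega>)"
    proof (rule likelihood_ratio_test_optimal[OF GL HL a _ XT])
      show "X \<in> randomized_tests M" using X by (simp add: feasible_def)
      show "AE \<omega> in M. (a * H \<omega> < G \<omega> \<longrightarrow> X' \<omega> = 1) \<and> (G \<omega> < a * H \<omega> \<longrightarrow> X' \<omega> = 0)"
        by (rule AE_I2) (auto simp: form)
    qed (use H_le[OF X] size in auto)
    \<comment> \<open>By \<open>least\<close>, the infimum at \<open>X'\<close> is attained at
      \<open>G\<close>, so a bound against this one \<open>G\<close> bounds the worst power.\<close>
    also have "\<dots> \<le> worst_power M \<G> (indicator ?A)"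
      unfolding worst_power_def eq by (rule INF_greatest[OF least])
    finally show ?thesis .
  qed
  then show ?thesis using feas by blast
qed

end

theorem theorem2p10:
  fixes M :: "'a measure" and \<G> \<H> :: "('a \<Rightarrow> real) set"
  assumes "prob_space M" and "complete_measure M"
    and "\<G> \<subseteq> L0_plus M" and "\<H> \<subseteq> L0_plus M"
    and "(SUP Z\<in>\<G> \<union> \<H>. expect M Z) < \<top>"
    and "rv_convex \<G>" and "closedin (prob_topology M) \<G>"
    and "condition_C1 M \<G> \<H> \<or> condition_C2 M \<G> \<H> \<or> condition_C3 M \<G> \<H>"
  shows "(\<forall>x>0. V1 M \<G> \<H> x = V M \<G> \<H> x \<and>
            (\<exists>X'\<in>pure_tests M. solves_V M \<G> \<H> x X' \<and> solves_V1 M \<G> \<H> x X')) \<and>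
         continuous_on {0<..} (V1 M \<G> \<H>) \<and>
         concave_on {0<..} (\<lambda>x. enn2real (V1 M \<G> \<H> x)) \<and>
         mono_on {0<..} (V1 M \<G> \<H>)"
proof -
  interpret prob_space M by fact
  have fin: "expect M Z < \<top>" if "Z \<in> \<G> \<union> \<H>" for Z
    using le_less_trans[OF SUP_upper[OF that] assms(5)] .
  have "\<exists>X'\<in>feasible M (pure_tests M) \<H> x.
      \<forall>X\<in>feasible M (randomized_tests M) \<H> x. worst_power M \<G> X \<le> worst_power M \<G> X'"
    if "0 < x" for x
    using assms(8)
  proof (elim disjE)
    assume "condition_C1 M \<G> \<H>"
    then show ?thesis using fin by (intro pure_optimal_C1[OF assms(3,4) _ _ that]) auto
  next
    assume "condition_C2 M \<G> \<H>"
    then show ?thesis using fin by (intro pure_optimal_C2[OF assms(3) _ assms(4) _ _ that]) auto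
  next
    assume "condition_C3 M \<G> \<H>"
    then show ?thesis by (rule pure_optimal_C3[OF assms(3,4) _ that])
  qed
  then show ?thesis
    using fin by (intro V1_properties_if_pure_optimal[OF assms(3) _ assms(4)]) auto
qed

end
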